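(* Let $M$ be a matroid on a finite linearly ordered set $E$. Then $$t(M;x,y)=\sum\ \Bigl(\prod_{1\leq k\leq \iota}\beta\bigl(M(F_k)/F_{k-1}\bigr)\Bigr)\Bigl(\prod_{1\leq k\leq \varepsilon}\beta^*\bigl(M(F'_{k-1})/F'_{k}\bigr)\Bigr)\,x^{\iota}y^{\varepsilon},$$ where the sum can be equally taken either over all connected filtrations $\emptyset=F'_\varepsilon\subset\dots\subset F'_0=F_c=F_0\subset\dots\subset F_\iota=E$ of $M$, or over all filtrations $\emptyset=F'_\varepsilon\subset\dots\subset F'_0=F_c=F_0\subset\dots\subset F_\iota=E$ of $E$ (the lengths $\iota,\varepsilon\ge 0$ vary with the filtration).
   Context: $\subset$ denotes strict inclusion. For $A\subseteq G\subseteq E$, $M(G)$ is the restriction of $M$ to $G$, and $M(G)/A$ is the minor obtained by restricting to $G$ and contracting $A$. $t(M;x,y)$ is the Tutte polynomial of $M$. The beta invariant $\beta(M)$ is the coefficient of $x$ in $t(M;x,y)$; in particular $\beta(M)=1$ if $M$ is an isthmus (a single coloop, $U_{1,1}$) and $\beta(M)=0$ if $M$ is a loop (a single loop element). One sets $\beta^*(M)=\beta(M^* )$, where $M^*$ is the dual; thus $\beta^*(M)=\beta(M)$ if $|E|>1$, $\beta^*(M)=0$ if $M$ is an isthmus, and $\beta^*(M)=1$ if $M$ is a loop. A filtration of $M$ (or of $E$) is a sequence $(F'_\varepsilon,\dots,F'_0,F_c,F_0,\dots,F_\iota)$ of subsets of $E$ (with $\iota,\varepsilon\ge 0$) such that: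 $\emptyset=F'_\varepsilon\subset\dots\subset F'_0=F_c=F_0\subset\dots\subset F_\iota=E$; the sequence $\min(F_k\setminus F_{k-1})$, $1\le k\le\iota$, is increasing with $k$; and the sequence $\min(F'_{k-1}\setminus F'_k)$, $1\le k\le\varepsilon$, is increasing with $k$. It is a connected filtration of $M$ if in addition: for $1\le k\le\iota$, the minor $M(F_k)/F_{k-1}$ is connected and is not a loop; and for $1\le k\le\varepsilon$, the minor $M(F'_{k-1})/F'_k$ is connected and is not an isthmus. (One-element matroids are connected.) *)

theory Defs
  imports "HOL-Computational_Algebra.Polynomial"
begin

section \<open>Matroids\<close>

record 'a set_system =
  ground :: "'a set"
  indeps :: "'a set set"

definition matroid :: "'a set_system \<Rightarrow> bool" where
  "matroid M \<longleftrightarrow>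
     finite (ground M) \<and>
     indeps M \<subseteq> Pow (ground M) \<and>
     {} \<in> indeps M \<and>
     (\<forall>I\<in>indeps M. \<forall>J. J \<subseteq> I \<longrightarrow> J \<in> indeps M) \<and>
     (\<forall>I\<in>indeps M. \<forall>J\<in>indeps M. card I < card J \<longrightarrow> (\<exists>e\<in>J - I. insert e I \<in> indeps M))"

definition bases :: "'a set_system \<Rightarrow> 'a set set" where
  "bases M = {B \<in> indeps M. \<forall>I\<in>indeps M. B \<subseteq> I \<longrightarrow> I = B}"

definition rank :: "'a set_system \<Rightarrow> 'a set \<Rightarrow> nat" where
  "rank M A = Max (card ` {I \<in> indeps M. I \<subseteq> A})"

definition restriction :: "'a set_system \<Rightarrow> 'a set \<Rightarrow> 'a set_system" where
  "restriction M G = \<lparr>ground = G, indeps = {I \<in> indeps M. I \<subseteq> G}\<rparr>"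

definition contraction :: "'a set_system \<Rightarrow> 'a set \<Rightarrow> 'a set_system" where
  "contraction M A =
     \<lparr>ground = ground M - A,
      indeps = {I. I \<subseteq> ground M - A \<and> (\<exists>B\<in>bases (restriction M A). I \<union> B \<in> indeps M)}\<rparr>"

text \<open>The minor $M(G)/A$, used for $A \subseteq G \subseteq E$.\<close>

definition minor :: "'a set_system \<Rightarrow> 'a set \<Rightarrow> 'a set \<Rightarrow> 'a set_system" where
  "minor M G A = contraction (restriction M G) A"

definition dual :: "'a set_system \<Rightarrow> 'a set_system" where
  "dual M =
     \<lparr>ground = ground M,
      indeps = {I. I \<subseteq> ground M \<and> (\<exists>B\<in>bases M. I \<inter> B = {})}\<rparr>"

definition direct_sum :: "'a set_system \<Rightarrow> 'a set_system \<Rightarrow> 'a set_system" where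
  "direct_sum M N =
     \<lparr>ground = ground M \<union> ground N,
      indeps = {I \<union> J | I J. I \<in> indeps M \<and> J \<in> indeps N}\<rparr>"

definition connected_matroid :: "'a set_system \<Rightarrow> bool" where
  "connected_matroid M \<longleftrightarrow>
     \<not> (\<exists>M1 M2. matroid M1 \<and> matroid M2 \<and> ground M1 \<noteq> {} \<and> ground M2 \<noteq> {} \<and>
          ground M1 \<inter> ground M2 = {} \<and> M = direct_sum M1 M2)"

definition is_loop :: "'a set_system \<Rightarrow> bool" where
  "is_loop M \<longleftrightarrow> (\<exists>e. ground M = {e} \<and> {e} \<notin> indeps M)"

definition is_isthmus :: "'a set_system \<Rightarrow> bool" where
  "is_isthmus M \<longleftrightarrow> (\<exists>e. ground M = {e} \<and> {e} \<in> indeps M)"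


section \<open>The Tutte polynomial and the beta invariant\<close>

text \<open>
  Polynomials in $x$ and $y$ over the integers are elements of \<^typ>\<open>int poly poly\<close>, read as
  polynomials in $y$ whose coefficients are polynomials in $x$. The coefficient of $x^i y^j$ in
  \<^term>\<open>p\<close> is therefore \<^term>\<open>coeff (coeff p j) i\<close>.
\<close>

definition varX :: "int poly poly" where
  "varX = [:[:0, 1:]:]"

definition varY :: "int poly poly" where
  "varY = [:0, 1:]"

text \<open>The natural number subtractions in the exponents do not truncate for a matroid.\<close>

definition tutte :: "'a set_system \<Rightarrow> int poly poly" where
  "tutte M = (\<Sum>A\<in>Pow (ground M).
     (varX - 1) ^ (rank M (ground M) - rank M A) * (varY - 1) ^ (card A - rank M A))"

definition beta :: "'a set_system \<Rightarrow> int" where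
  "beta M = coeff (coeff (tutte M) 0) 1"

definition beta_dual :: "'a set_system \<Rightarrow> int" where
  "beta_dual M = beta (dual M)"


section \<open>Filtrations\<close>

text \<open>
  A filtration $(F'_\varepsilon, \dots, F'_0, F_c, F_0, \dots, F_\iota)$ is given by the list
  \<open>F'\<close> $= [F'_0, \dots, F'_\varepsilon]$ (in order of increasing index, so decreasing for
  inclusion), the set $F_c$, and the list \<open>F\<close> $= [F_0, \dots, F_\iota]$. The lists are nonempty,
  and $\varepsilon$ and $\iota$ are their lengths minus one.
\<close>

definition filtration ::
    "'a::linorder set \<Rightarrow> 'a set list \<Rightarrow> 'a set \<Rightarrow> 'a set list \<Rightarrow> bool" where
  "filtration E F' Fc F \<longleftrightarrow>
     F' \<noteq> [] \<and> F \<noteq> [] \<and>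
     last F' = {} \<and> hd F' = Fc \<and> Fc = hd F \<and> last F = E \<and>
     (\<forall>k\<in>{1..length F - 1}. F ! (k - 1) \<subset> F ! k) \<and>
     (\<forall>k\<in>{1..length F' - 1}. F' ! k \<subset> F' ! (k - 1)) \<and>
     strict_mono_on {1..length F - 1} (\<lambda>k. Min (F ! k - F ! (k - 1))) \<and>
     strict_mono_on {1..length F' - 1} (\<lambda>k. Min (F' ! (k - 1) - F' ! k))"

definition connected_filtration ::
    "'a::linorder set_system \<Rightarrow> 'a set list \<Rightarrow> 'a set \<Rightarrow> 'a set list \<Rightarrow> bool" where
  "connected_filtration M F' Fc F \<longleftrightarrow>
     filtration (ground M) F' Fc F \<and>
     (\<forall>k\<in>{1..length F - 1}.
        connected_matroid (minor M (F ! k) (F ! (k - 1))) \<and>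
        \<not> is_loop (minor M (F ! k) (F ! (k - 1)))) \<and>
     (\<forall>k\<in>{1..length F' - 1}.
        connected_matroid (minor M (F' ! (k - 1)) (F' ! k)) \<and>
        \<not> is_isthmus (minor M (F' ! (k - 1)) (F' ! k)))"

definition filtration_term ::
    "'a set_system \<Rightarrow> 'a set list \<Rightarrow> 'a set list \<Rightarrow> int poly poly" where
  "filtration_term M F' F =
     of_int (\<Prod>k = 1..length F - 1. beta (minor M (F ! k) (F ! (k - 1)))) *
     of_int (\<Prod>k = 1..length F' - 1. beta_dual (minor M (F' ! (k - 1)) (F' ! k))) *
     varX ^ (length F - 1) * varY ^ (length F' - 1)"

end

theory Submission
  imports Defs
begin

text \<open>
  Both halves of a filtration come from expanding \<open>t(M; x, y)\<close> as a sum over subsets and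
  cancelling alternating sums over intervals of sets. First,
  \<open>t(M; x, y) = \<Sum>\<^sub>F t(M/F; x, 0) t(M(F); 0, y)\<close> over all subsets \<open>F\<close>, which becomes \<open>F\<^sub>c\<close>.
  Second, with \<open>p = min E\<close>, \<open>t(M; x, 0) = x \<Sum>\<^sub>F \<beta>(M(F)) t(M/F; x, 0)\<close> over all \<open>F\<close> containing
  \<open>p\<close>: the inner alternating sum leaves only pairs \<open>X, X \<union> {p}\<close>, and the factor \<open>x\<close> turns the
  resulting rank difference into a telescoping difference of powers of \<open>1 - x\<close>. Since the block
  minima of a filtration increase exactly when each block contains the minimum of what is left,
  iterating this recursion runs over the upper parts of filtrations. The lower parts are treated
  in the same way after complementation, with nullity in place of rank. Finally, \<open>\<beta>\<close> and
  \<open>\<beta>\<^sup>*\<close> are alternating sums of rank and nullity, which are additive over direct sums, so they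
  vanish on disconnected matroids and the filtrations that are not connected contribute zero.
\<close>

section \<open>Alternating sums over intervals of sets\<close>

lemma finite_set_interval: "finite B \<Longrightarrow> finite {A..B :: 'a set}"
  by (rule finite_subset[of _ "Pow B"]) auto

lemma sum_set_interval_split:
  fixes h :: "'a set \<Rightarrow> 'b::comm_monoid_add"
  assumes "finite B" "p \<in> B - A"
  shows "(\<Sum>X\<in>{A..B}. h X) = (\<Sum>X\<in>{A..B - {p}}. h X + h (insert p X))"
proof -
  have eq: "{A..B} = {A..B - {p}} \<union> insert p ` {A..B - {p}}"
  proof (intro equalityI subsetI)
    fix X assume X: "X \<in> {A..B}"
    show "X \<in> {A..B - {p}} \<union> insert p ` {A..B - {p}}"
    proof (cases "p \<in> X")
      case True
      then have "X = insert p (X - {p})" "X - {p} \<in> {A..B - {p}}"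
        using X assms(2) by auto
      then show ?thesis by blast
    qed (use X in auto)
  qed (use assms(2) in auto)
  have inj: "inj_on (insert p) {A..B - {p}}"
    by (rule inj_onI) (auto simp: subset_Diff_insert insert_ident)
  have "(\<Sum>X\<in>{A..B}. h X) = (\<Sum>X\<in>{A..B - {p}}. h X) + (\<Sum>X\<in>insert p ` {A..B - {p}}. h X)"
    unfolding eq by (rule sum.union_disjoint) (use assms(1) in \<open>auto simp: finite_set_interval\<close>)
  also have "\<dots> = (\<Sum>X\<in>{A..B - {p}}. h X) + (\<Sum>X\<in>{A..B - {p}}. h (insert p X))"
    by (simp add: sum.reindex[OF inj])
  finally show ?thesis by (simp add: sum.distrib)
qed

lemma card_insert_set_interval:
  assumes "finite B" "X \<in> {A..B - {p}}"
  shows "card (insert p X) = Suc (card X)"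
proof -
  have "finite X" "p \<notin> X" using assms finite_subset[of X B] by auto
  then show ?thesis by simp
qed

text \<open>If \<open>A\<close> is a proper subset of \<open>B\<close>, adding or removing one
  element \<open>p\<close> of \<open>B - A\<close> pairs sets of opposite sign. If \<open>A\<close>
  is not contained in \<open>B\<close>, the interval is empty. Only the one-point interval is
  left.\<close>

lemma sum_alternating_set_interval:
  assumes "finite B"
  shows "(\<Sum>F\<in>{A..B}. (-1) ^ card F :: 'r::comm_ring_1) = (if A = B then (-1) ^ card A else 0)"
proof (cases "A \<subset> B")
  case True
  then obtain p where "p \<in> B - A" by blast
  then have "(\<Sum>F\<in>{A..B}. (-1) ^ card F :: 'r) =
      (\<Sum>F\<in>{A..B - {p}}. (-1) ^ card F + (-1) ^ card (insert p F))"
    by (rule sum_set_interval_split[OF assms])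
  also have "\<dots> = 0"
    by (rule sum.neutral) (use card_insert_set_interval[OF assms] in auto)
  finally show ?thesis using True by auto
next
  case False
  show ?thesis
  proof (cases "A = B")
    case False
    then have "{A..B} = {}" using \<open>\<not> A \<subset> B\<close> by auto
    then show ?thesis using False by simp
  qed simp
qed

text \<open>After the sums are exchanged, for fixed \<open>X\<close> and \<open>Y\<close> the set
  \<open>F\<close> runs over the interval from \<open>X Un C\<close> to \<open>Y Int D\<close>,
  whose alternating sum vanishes unless its ends coincide. The extra bounds \<open>C\<close> and
  \<open>D\<close> allow \<open>F\<close> to be forced to contain, or to avoid, a chosen
  element.\<close>

lemma sum_alternating_convolution:
  fixes a b :: "'a set \<Rightarrow> 'r::comm_ring_1"
  assumes "finite G" "A \<subseteq> C" "D \<subseteq> G"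
  shows "(\<Sum>F\<in>{C..D}. (-1) ^ card F * (\<Sum>X\<in>{A..F}. a X) * (\<Sum>Y\<in>{F..G}. b Y)) =
    (\<Sum>X\<in>{A..G}. \<Sum>Y\<in>{A..G}. if X \<union> C = Y \<inter> D then (-1) ^ card (X \<union> C) * a X * b Y else 0)"
proof -
  have fin: "finite {A..G}" "finite {C..D}"
    using assms finite_subset[of D G] by (auto intro: finite_set_interval)
  \<comment> \<open>Both inner sums are padded with zeros to the common range \<open>{A..G}\<close>,
    so that their ranges no longer depend on \<open>F\<close>.\<close>
  have "(\<Sum>F\<in>{C..D}. (-1) ^ card F * (\<Sum>X\<in>{A..F}. a X) * (\<Sum>Y\<in>{F..G}. b Y)) =
     (\<Sum>F\<in>{C..D}. (-1) ^ card F * (\<Sum>X\<in>{A..G}. if X \<subseteq> F then a X else 0)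
        * (\<Sum>Y\<in>{A..G}. if F \<subseteq> Y then b Y else 0))"
  proof (rule sum.cong[OF refl])
    fix F assume F: "F \<in> {C..D}"
    have "F \<subseteq> G" using F assms by auto
    then have "{A..F} = {X \<in> {A..G}. X \<subseteq> F}" by fastforce
    then have "(\<Sum>X\<in>{A..F}. a X) = (\<Sum>X\<in>{A..G}. if X \<subseteq> F then a X else 0)"
      by (simp only: sum.inter_filter[OF fin(1)])
    moreover have "{F..G} = {Y \<in> {A..G}. F \<subseteq> Y}" using F assms(2) by fastforce
    then have "(\<Sum>Y\<in>{F..G}. b Y) = (\<Sum>Y\<in>{A..G}. if F \<subseteq> Y then b Y else 0)"
      by (simp only: sum.inter_filter[OF fin(1)])
    ultimately show "(-1) ^ card F * (\<Sum>X\<in>{A..F}. a X) * (\<Sum>Y\<in>{F..G}. b Y) =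
        (-1) ^ card F * (\<Sum>X\<in>{A..G}. if X \<subseteq> F then a X else 0)
        * (\<Sum>Y\<in>{A..G}. if F \<subseteq> Y then b Y else 0)" by simp
  qed
  also have "\<dots> = (\<Sum>F\<in>{C..D}. \<Sum>X\<in>{A..G}. \<Sum>Y\<in>{A..G}.
      if X \<subseteq> F \<and> F \<subseteq> Y then (-1) ^ card F * (a X * b Y) else 0)"
    unfolding sum_distrib_left sum_distrib_right mult.assoc
    by (subst (2) sum.swap) (intro sum.cong refl, auto)
  also have "\<dots> = (\<Sum>X\<in>{A..G}. \<Sum>Y\<in>{A..G}. \<Sum>F\<in>{C..D}.
      if X \<subseteq> F \<and> F \<subseteq> Y then (-1) ^ card F * (a X * b Y) else 0)"
    by (subst sum.swap, rule sum.cong[OF refl], rule sum.swap)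
  also have "\<dots> = (\<Sum>X\<in>{A..G}. \<Sum>Y\<in>{A..G}.
      if X \<union> C = Y \<inter> D then (-1) ^ card (X \<union> C) * a X * b Y else 0)"
  proof (intro sum.cong refl)
    fix X Y
    have "(\<Sum>F\<in>{C..D}. if X \<subseteq> F \<and> F \<subseteq> Y then (-1) ^ card F * (a X * b Y) else 0) =
        (\<Sum>F\<in>{X \<union> C..Y \<inter> D}. (-1) ^ card F * (a X * b Y))"
      by (subst sum.inter_filter[OF fin(2), symmetric], rule sum.cong) auto
    also have "\<dots> = (\<Sum>F\<in>{X \<union> C..Y \<inter> D}. (-1) ^ card F) * (a X * b Y)"
      by (simp add: sum_distrib_right)
    also have "(\<Sum>F\<in>{X \<union> C..Y \<inter> D}. (-1) ^ card F) =
        (if X \<union> C = Y \<inter> D then (-1) ^ card (X \<union> C) else (0 :: 'r))"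
      by (rule sum_alternating_set_interval) (use assms finite_subset[of D G] in auto)
    finally show "(\<Sum>F\<in>{C..D}. if X \<subseteq> F \<and> F \<subseteq> Y then (-1) ^ card F * (a X * b Y) else 0) =
        (if X \<union> C = Y \<inter> D then (-1) ^ card (X \<union> C) * a X * b Y else 0)"
      by (simp add: mult.assoc)
  qed
  finally show ?thesis .
qed

text \<open>The case \<open>C = A\<close>, \<open>D = G\<close>: the surviving condition is
  \<open>X = Y\<close>.\<close>

lemma sum_alternating_convolution_full:
  fixes a b :: "'a set \<Rightarrow> 'r::comm_ring_1"
  assumes "finite G"
  shows "(\<Sum>F\<in>{A..G}. (-1) ^ card F * (\<Sum>X\<in>{A..F}. a X) * (\<Sum>Y\<in>{F..G}. b Y)) =
    (\<Sum>X\<in>{A..G}. (-1) ^ card X * a X * b X)"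
proof -
  have "(if X \<union> A = Y \<inter> G then (-1) ^ card (X \<union> A) * a X * b Y else 0) =
      (if X = Y then (-1) ^ card X * a X * b Y else 0)"
    if "X \<in> {A..G}" "Y \<in> {A..G}" for X Y
  proof -
    have eq: "X \<union> A = X" "Y \<inter> G = Y" using that by auto
    show ?thesis unfolding eq by simp
  qed
  then have "(\<Sum>X\<in>{A..G}. \<Sum>Y\<in>{A..G}. if X \<union> A = Y \<inter> G
        then (-1) ^ card (X \<union> A) * a X * b Y else 0) =
      (\<Sum>X\<in>{A..G}. \<Sum>Y\<in>{A..G}. if X = Y then (-1) ^ card X * a X * b Y else 0)"
    by (intro sum.cong refl)
  then show ?thesis
    by (simp add: sum_alternating_convolution[OF assms] finite_set_interval[OF assms])
qed

text \<open>The case \<open>C = insert p A\<close>, \<open>D = G\<close>: the surviving condition is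
  \<open>Y = insert p X\<close>. The sets \<open>X\<close> and \<open>insert p X\<close> lead to the
  same \<open>Y\<close>, so their \<open>a\<close>-values are grouped; the minus sign comes from the
  extra element \<open>p\<close>.\<close>

lemma sum_alternating_convolution_mem:
  fixes a b :: "'a set \<Rightarrow> 'r::comm_ring_1"
  assumes "finite G" "p \<in> G - A"
  shows "(\<Sum>F\<in>{insert p A..G}. (-1) ^ card F * (\<Sum>X\<in>{A..F}. a X) * (\<Sum>Y\<in>{F..G}. b Y)) =
    (\<Sum>X\<in>{A..G - {p}}. - ((-1) ^ card X * (a X + a (insert p X)) * b (insert p X)))"
proof -
  have "(\<Sum>F\<in>{insert p A..G}. (-1) ^ card F * (\<Sum>X\<in>{A..F}. a X) * (\<Sum>Y\<in>{F..G}. b Y)) =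
    (\<Sum>X\<in>{A..G}. \<Sum>Y\<in>{A..G}. if X \<union> insert p A = Y \<inter> G
       then (-1) ^ card (X \<union> insert p A) * a X * b Y else 0)"
    by (rule sum_alternating_convolution) (use assms in auto)
  also have "\<dots> = (\<Sum>X\<in>{A..G}. (-1) ^ card (insert p X) * a X * b (insert p X))"
  proof (rule sum.cong[OF refl])
    fix X assume X: "X \<in> {A..G}"
    have "(\<Sum>Y\<in>{A..G}. if X \<union> insert p A = Y \<inter> G
        then (-1) ^ card (X \<union> insert p A) * a X * b Y else 0) =
      (\<Sum>Y\<in>{A..G}. if Y = insert p X then (-1) ^ card (insert p X) * a X * b Y else 0)"
    proof (rule sum.cong[OF refl])
      fix Y assume "Y \<in> {A..G}"
      then have "X \<union> insert p A = insert p X" "Y \<inter> G = Y" using X by auto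
      then show "(if X \<union> insert p A = Y \<inter> G
        then (-1) ^ card (X \<union> insert p A) * a X * b Y else 0) =
        (if Y = insert p X then (-1) ^ card (insert p X) * a X * b Y else 0)" by auto
    qed
    also have "\<dots> = (-1) ^ card (insert p X) * a X * b (insert p X)"
      using X assms by (simp add: finite_set_interval) blast
    finally show "(\<Sum>Y\<in>{A..G}. if X \<union> insert p A = Y \<inter> G
        then (-1) ^ card (X \<union> insert p A) * a X * b Y else 0) =
        (-1) ^ card (insert p X) * a X * b (insert p X)" .
  qed
  also have "\<dots> = (\<Sum>X\<in>{A..G - {p}}. - ((-1) ^ card X * (a X + a (insert p X)) * b (insert p X)))"
    unfolding sum_set_interval_split[OF assms]
    by (rule sum.cong)
      (use card_insert_set_interval[OF assms(1)] in \<open>auto simp: algebra_simps\<close>)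
  finally show ?thesis .
qed

text \<open>The mirror case \<open>C = A\<close>, \<open>D = G - {p}\<close>: the surviving
  condition is \<open>X = Y - {p}\<close>, so it is now the two \<open>b\<close>-values at
  \<open>X\<close> and \<open>insert p X\<close> that are grouped.\<close>

lemma sum_alternating_convolution_not_mem:
  fixes a b :: "'a set \<Rightarrow> 'r::comm_ring_1"
  assumes "finite G" "p \<in> G - A"
  shows "(\<Sum>F\<in>{A..G - {p}}. (-1) ^ card F * (\<Sum>X\<in>{A..F}. a X) * (\<Sum>Y\<in>{F..G}. b Y)) =
    (\<Sum>X\<in>{A..G - {p}}. (-1) ^ card X * a X * (b X + b (insert p X)))"
proof -
  have fin: "finite {A..G - {p}}" using assms by (auto intro: finite_set_interval)
  have "(\<Sum>F\<in>{A..G - {p}}. (-1) ^ card F * (\<Sum>X\<in>{A..F}. a X) * (\<Sum>Y\<in>{F..G}. b Y)) =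
    (\<Sum>X\<in>{A..G}. \<Sum>Y\<in>{A..G}. if X \<union> A = Y \<inter> (G - {p})
       then (-1) ^ card (X \<union> A) * a X * b Y else 0)"
    by (rule sum_alternating_convolution) (use assms in auto)
  also have "\<dots> = (\<Sum>X\<in>{A..G}. \<Sum>Y\<in>{A..G - {p}}. if X = Y
       then (-1) ^ card X * a X * (b Y + b (insert p Y)) else 0)"
  proof (rule sum.cong[OF refl])
    fix X assume X: "X \<in> {A..G}"
    have "(\<Sum>Y\<in>{A..G}. if X \<union> A = Y \<inter> (G - {p}) then (-1) ^ card (X \<union> A) * a X * b Y else 0) =
      (\<Sum>Y\<in>{A..G - {p}}.
        (if X \<union> A = Y \<inter> (G - {p}) then (-1) ^ card (X \<union> A) * a X * b Y else 0) +
        (if X \<union> A = insert p Y \<inter> (G - {p}) then (-1) ^ card (X \<union> A) * a X * b (insert p Y) else 0))"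
      by (rule sum_set_interval_split[OF assms])
    also have "\<dots> = (\<Sum>Y\<in>{A..G - {p}}. if X = Y
       then (-1) ^ card X * a X * (b Y + b (insert p Y)) else 0)"
    proof (rule sum.cong[OF refl])
      fix Y assume "Y \<in> {A..G - {p}}"
      then have eq: "X \<union> A = X" "Y \<inter> (G - {p}) = Y" "insert p Y \<inter> (G - {p}) = Y"
        using X by auto
      show "(if X \<union> A = Y \<inter> (G - {p}) then (-1) ^ card (X \<union> A) * a X * b Y else 0) +
        (if X \<union> A = insert p Y \<inter> (G - {p}) then (-1) ^ card (X \<union> A) * a X * b (insert p Y) else 0)
        = (if X = Y then (-1) ^ card X * a X * (b Y + b (insert p Y)) else 0)"
        unfolding eq by (simp add: distrib_left)
    qed
    finally show "(\<Sum>Y\<in>{A..G}. if X \<union> A = Y \<inter> (G - {p})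
        then (-1) ^ card (X \<union> A) * a X * b Y else 0) = (\<Sum>Y\<in>{A..G - {p}}. if X = Y
        then (-1) ^ card X * a X * (b Y + b (insert p Y)) else 0)" .
  qed
  also have "\<dots> = (\<Sum>Y\<in>{A..G - {p}}. \<Sum>X\<in>{A..G}. if X = Y
       then (-1) ^ card X * a X * (b Y + b (insert p Y)) else 0)"
    by (rule sum.swap)
  also have "\<dots> = (\<Sum>X\<in>{A..G - {p}}. (-1) ^ card X * a X * (b X + b (insert p X)))"
  proof (rule sum.cong[OF refl])
    fix Y assume Y: "Y \<in> {A..G - {p}}"
    have "(\<Sum>X\<in>{A..G}. if X = Y then (-1) ^ card X * a X * (b Y + b (insert p Y)) else 0) =
       (if Y \<in> {A..G} then (-1) ^ card Y * a Y * (b Y + b (insert p Y)) else 0)"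
      by (rule sum.delta) (use assms in \<open>auto intro: finite_set_interval\<close>)
    then show "(\<Sum>X\<in>{A..G}. if X = Y then (-1) ^ card X * a X * (b Y + b (insert p Y)) else 0) =
        (-1) ^ card Y * a Y * (b Y + b (insert p Y))" using Y by auto
  qed
  finally show ?thesis .
qed

section \<open>Rank functions of matroids and their minors\<close>

lemma matroidI:
  assumes "finite (ground M)" "\<And>I. I \<in> indeps M \<Longrightarrow> I \<subseteq> ground M" "{} \<in> indeps M"
    "\<And>I J. I \<in> indeps M \<Longrightarrow> J \<subseteq> I \<Longrightarrow> J \<in> indeps M"
    "\<And>I J. I \<in> indeps M \<Longrightarrow> J \<in> indeps M \<Longrightarrow> card I < card J \<Longrightarrow> \<exists>e\<in>J - I. insert e I \<in> indeps M"
  shows "matroid M"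
proof -
  have "\<forall>I\<in>indeps M. \<forall>J. J \<subseteq> I \<longrightarrow> J \<in> indeps M" using assms(4) by blast
  moreover have "\<forall>I\<in>indeps M. \<forall>J\<in>indeps M. card I < card J \<longrightarrow> (\<exists>e\<in>J - I. insert e I \<in> indeps M)"
    using assms(5) by blast
  moreover have "indeps M \<subseteq> Pow (ground M)" using assms(2) by blast
  ultimately show ?thesis unfolding matroid_def by (intro conjI assms(1,3))
qed

lemma finite_indeps: "matroid M \<Longrightarrow> finite (indeps M)"
  unfolding matroid_def by (meson finite_Pow_iff finite_subset)

lemma matroid_finite_ground: "matroid M \<Longrightarrow> finite (ground M)"
  unfolding matroid_def by blast

lemma indep_subset_ground: "matroid M \<Longrightarrow> I \<in> indeps M \<Longrightarrow> I \<subseteq> ground M"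
  unfolding matroid_def by blast

lemma indep_finite: "matroid M \<Longrightarrow> I \<in> indeps M \<Longrightarrow> finite I"
  by (meson finite_subset indep_subset_ground matroid_finite_ground)

lemma indep_empty: "matroid M \<Longrightarrow> {} \<in> indeps M"
  unfolding matroid_def by blast

lemma indep_subset: "matroid M \<Longrightarrow> I \<in> indeps M \<Longrightarrow> J \<subseteq> I \<Longrightarrow> J \<in> indeps M"
proof -
  assume "matroid M"
  then have "\<forall>I\<in>indeps M. \<forall>J. J \<subseteq> I \<longrightarrow> J \<in> indeps M" unfolding matroid_def by (elim conjE)
  then show "I \<in> indeps M \<Longrightarrow> J \<subseteq> I \<Longrightarrow> J \<in> indeps M" by blast
qed

lemma indep_augment:
  assumes "matroid M" "I \<in> indeps M" "J \<in> indeps M" "card I < card J"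
  obtains e where "e \<in> J - I" "insert e I \<in> indeps M"
proof -
  have "\<forall>I\<in>indeps M. \<forall>J\<in>indeps M. card I < card J \<longrightarrow> (\<exists>e\<in>J - I. insert e I \<in> indeps M)"
    using assms(1) unfolding matroid_def by (elim conjE)
  then show ?thesis using assms(2-4) that by blast
qed

lemma card_indep_le_rank:
  assumes "matroid M" "I \<in> indeps M" "I \<subseteq> A"
  shows "card I \<le> rank M A"
  unfolding rank_def by (rule Max_ge) (use assms finite_indeps[OF assms(1)] in auto)

lemma rank_attained:
  assumes "matroid M"
  obtains I where "I \<in> indeps M" "I \<subseteq> A" "card I = rank M A"
proof -
  have "rank M A \<in> card ` {I \<in> indeps M. I \<subseteq> A}"
    unfolding rank_def
    by (rule Max_in) (use finite_indeps[OF assms] indep_empty[OF assms] in auto)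
  then show ?thesis using that by auto
qed

text \<open>Augmenting from an independent subset of \<open>A\<close> of full rank only adds
  elements of \<open>A\<close>. The induction is on the number of elements still missing.\<close>

lemma indep_extend_in:
  assumes "matroid M" "I \<in> indeps M" "I \<subseteq> A"
  obtains J where "J \<in> indeps M" "I \<subseteq> J" "J \<subseteq> A" "card J = rank M A"
proof -
  have "\<exists>J. J \<in> indeps M \<and> I \<subseteq> J \<and> J \<subseteq> A \<and> card J = rank M A"
    using assms(2,3)
  proof (induction "rank M A - card I" arbitrary: I rule: less_induct)
    case less
    show ?case
    proof (cases "card I < rank M A")
      case True
      obtain K where K: "K \<in> indeps M" "K \<subseteq> A" "card K = rank M A"
        using rank_attained[OF assms(1)] by blast
      obtain e where e: "e \<in> K - I" "insert e I \<in> indeps M"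
        using indep_augment[OF assms(1) less.prems(1) K(1)] True K(3) by auto
      have "card (insert e I) = Suc (card I)"
        using e indep_finite[OF assms(1) less.prems(1)] by simp
      then have "\<exists>J. J \<in> indeps M \<and> insert e I \<subseteq> J \<and> J \<subseteq> A \<and> card J = rank M A"
        using True e K less.prems by (intro less.hyps) auto
      then show ?thesis by blast
    next
      case False
      then show ?thesis
        using less.prems card_indep_le_rank[OF assms(1) less.prems]
        by (intro exI[of _ I]) simp
    qed
  qed
  then show ?thesis using that by blast
qed

lemma rank_mono:
  assumes "matroid M" "A \<subseteq> B"
  shows "rank M A \<le> rank M B"
proof -
  obtain I where I: "I \<in> indeps M" "I \<subseteq> A" "card I = rank M A"
    using rank_attained[OF assms(1)] by blast
  then show ?thesis using card_indep_le_rank[OF assms(1) I(1), of B] assms(2) by simp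
qed

lemma rank_insert_le:
  assumes "matroid M"
  shows "rank M (insert e A) \<le> Suc (rank M A)"
proof -
  obtain I where I: "I \<in> indeps M" "I \<subseteq> insert e A" "card I = rank M (insert e A)"
    using rank_attained[OF assms] by blast
  have "card (I - {e}) \<le> rank M A"
    by (rule card_indep_le_rank[OF assms]) (use I indep_subset[OF assms I(1)] in auto)
  moreover have "card I \<le> Suc (card (I - {e}))"
    using card_Diff1_le[of I e] card_Suc_Diff1[OF indep_finite[OF assms I(1)], of e]
    by (cases "e \<in> I") simp_all
  ultimately show ?thesis using I by linarith
qed

lemma rank_le_card:
  assumes "matroid M" "finite A"
  shows "rank M A \<le> card A"
proof -
  obtain I where I: "I \<in> indeps M" "I \<subseteq> A" "card I = rank M A"
    using rank_attained[OF assms(1)] by blast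
  then show ?thesis using card_mono[OF assms(2) I(2)] by simp
qed

lemma rank_empty: "matroid M \<Longrightarrow> rank M {} = 0"
  using rank_le_card[of M "{}"] by simp

section \<open>Restriction, bases and contraction\<close>

lemma matroid_restriction:
  assumes "matroid M" "G \<subseteq> ground M"
  shows "matroid (restriction M G)"
proof (rule matroidI)
  fix I J assume IJ: "I \<in> indeps (restriction M G)" "J \<in> indeps (restriction M G)" "card I < card J"
  then have "I \<in> indeps M" "J \<in> indeps M" "I \<subseteq> G" "J \<subseteq> G" by (auto simp: restriction_def)
  moreover from this obtain e where "e \<in> J - I" "insert e I \<in> indeps M"
    using indep_augment[OF assms(1) _ _ IJ(3)] by blast
  ultimately show "\<exists>e\<in>J - I. insert e I \<in> indeps (restriction M G)"
    by (intro bexI[of _ e]) (auto simp: restriction_def)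
next
  show "finite (ground (restriction M G))"
    using assms matroid_finite_ground finite_subset by (auto simp: restriction_def)
next
  fix I J assume "I \<in> indeps (restriction M G)" "J \<subseteq> I"
  then show "J \<in> indeps (restriction M G)"
    using indep_subset[OF assms(1), of I J] by (auto simp: restriction_def)
qed (simp_all add: restriction_def indep_empty[OF assms(1)])

lemma rank_restriction: "X \<subseteq> G \<Longrightarrow> rank (restriction M G) X = rank M X"
proof -
  assume "X \<subseteq> G"
  then have "{I \<in> indeps (restriction M G). I \<subseteq> X} = {I \<in> indeps M. I \<subseteq> X}"
    by (auto simp: restriction_def)
  then show ?thesis by (simp add: rank_def)
qed

text \<open>Maximality for inclusion agrees with maximality for size, since every independent set
  extends to one of full rank.\<close>

lemma bases_iff_rank:
  assumes "matroid M"
  shows "B \<in> bases M \<longleftrightarrow> B \<in> indeps M \<and> card B = rank M (ground M)"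
proof
  assume B: "B \<in> bases M"
  then have ind: "B \<in> indeps M" and max: "\<And>I. I \<in> indeps M \<Longrightarrow> B \<subseteq> I \<Longrightarrow> I = B"
    unfolding bases_def by blast+
  obtain J where "J \<in> indeps M" "B \<subseteq> J" "card J = rank M (ground M)"
    using indep_extend_in[OF assms ind indep_subset_ground[OF assms ind]] by blast
  with max[of J] ind show "B \<in> indeps M \<and> card B = rank M (ground M)" by simp
next
  assume B: "B \<in> indeps M \<and> card B = rank M (ground M)"
  have "\<forall>I\<in>indeps M. B \<subseteq> I \<longrightarrow> I = B"
  proof (intro ballI impI)
    fix I assume I: "I \<in> indeps M" "B \<subseteq> I"
    have "card I \<le> card B"
      using B card_indep_le_rank[OF assms I(1) indep_subset_ground[OF assms I(1)]] by simp
    then show "I = B" using card_seteq[OF indep_finite[OF assms I(1)] I(2)] by simp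
  qed
  then show "B \<in> bases M" using B unfolding bases_def by blast
qed

lemma bases_restriction_iff:
  assumes "matroid M" "A \<subseteq> ground M"
  shows "B \<in> bases (restriction M A) \<longleftrightarrow> B \<in> indeps M \<and> B \<subseteq> A \<and> card B = rank M A"
proof -
  have "ground (restriction M A) = A" "indeps (restriction M A) = {I \<in> indeps M. I \<subseteq> A}"
    by (simp_all add: restriction_def)
  then show ?thesis
    using bases_iff_rank[OF matroid_restriction[OF assms], of B] by (auto simp: rank_restriction)
qed

text \<open>The definition of contraction asks for some basis of \<open>A\<close>; here one fixed
  basis \<open>B\<close> is shown to serve for every \<open>I\<close>. Extend \<open>B\<close> to a
  largest independent subset \<open>J\<close> of \<open>I Un A\<close>. Since \<open>J\<close> has
  at most \<open>rank M A\<close> elements in \<open>A\<close>, it must contain all of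
  \<open>I\<close>.\<close>

lemma contraction_indep_iff:
  assumes "matroid M" "A \<subseteq> ground M" "B \<in> indeps M" "B \<subseteq> A" "card B = rank M A"
  shows "I \<in> indeps (contraction M A) \<longleftrightarrow> I \<subseteq> ground M - A \<and> I \<union> B \<in> indeps M"
proof
  assume "I \<in> indeps (contraction M A)"
  then obtain C where I: "I \<subseteq> ground M - A" and C: "C \<in> indeps M" "C \<subseteq> A" "card C = rank M A"
    and IC: "I \<union> C \<in> indeps M"
    by (auto simp: contraction_def bases_restriction_iff[OF assms(1,2)])
  obtain J where J: "J \<in> indeps M" "B \<subseteq> J" "J \<subseteq> I \<union> A" "card J = rank M (I \<union> A)"
    using indep_extend_in[OF assms(1,3), of "I \<union> A"] assms(4) by blast
  have finI: "finite I" using IC indep_finite[OF assms(1)] by auto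
  have finJ: "finite J" and finB: "finite B" and finC: "finite C"
    using J(1) assms C indep_finite by blast+
  have "card (J \<inter> A) \<le> rank M A"
    by (rule card_indep_le_rank[OF assms(1) indep_subset[OF assms(1) J(1)]]) auto
  moreover have "card J = card (J \<inter> A) + card (J \<inter> I)"
  proof -
    have "J = (J \<inter> A) \<union> (J \<inter> I)" "(J \<inter> A) \<inter> (J \<inter> I) = {}" using J(3) I by auto
    then show ?thesis using card_Un_disjoint[of "J \<inter> A" "J \<inter> I"] finJ by simp
  qed
  moreover have "card (I \<union> C) \<le> card J"
    unfolding J(4) by (rule card_indep_le_rank[OF assms(1) IC]) (use C in auto)
  moreover have "card (I \<union> C) = card I + rank M A"
    using card_Un_disjoint[of I C] finI finC C I by auto
  ultimately have "card I \<le> card (J \<inter> I)" by linarith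
  then have "J \<inter> I = I" using card_seteq[OF finI, of "J \<inter> I"] by auto
  then have "I \<union> B \<subseteq> J" using J by auto
  then show "I \<subseteq> ground M - A \<and> I \<union> B \<in> indeps M" using I indep_subset[OF assms(1) J(1)] by blast
next
  assume "I \<subseteq> ground M - A \<and> I \<union> B \<in> indeps M"
  then show "I \<in> indeps (contraction M A)"
    using assms by (auto simp: contraction_def bases_restriction_iff[OF assms(1,2)])
qed

lemma matroid_contraction:
  assumes "matroid M" "A \<subseteq> ground M"
  shows "matroid (contraction M A)"
proof -
  obtain B where B: "B \<in> indeps M" "B \<subseteq> A" "card B = rank M A"
    using rank_attained[OF assms(1)] by blast
  note iff = contraction_indep_iff[OF assms B]
  have disj: "card (I \<union> B) = card I + card B" if "I \<in> indeps (contraction M A)" for I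
  proof -
    have "I \<inter> B = {}" "finite I" "finite B"
      using that B indep_finite[OF assms(1)] by (auto simp: iff)
    then show ?thesis by (simp add: card_Un_disjoint)
  qed
  have "\<exists>e\<in>J - I. insert e I \<in> indeps (contraction M A)"
    if I: "I \<in> indeps (contraction M A)" and J: "J \<in> indeps (contraction M A)" and "card I < card J" for I J
  proof -
    have "card (I \<union> B) < card (J \<union> B)" using disj[OF I] disj[OF J] that(3) by simp
    then obtain e where "e \<in> (J \<union> B) - (I \<union> B)" "insert e (I \<union> B) \<in> indeps M"
      using indep_augment[OF assms(1), of "I \<union> B" "J \<union> B"] I J by (auto simp: iff)
    then show ?thesis using I J by (intro bexI[of _ e]) (auto simp: iff)
  qed
  moreover have "J \<in> indeps (contraction M A)" if "I \<in> indeps (contraction M A)" "J \<subseteq> I" for I J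
    using that indep_subset[OF assms(1), of "I \<union> B" "J \<union> B"] by (auto simp: iff)
  moreover have "finite (ground (contraction M A))"
    using matroid_finite_ground[OF assms(1)] by (simp add: contraction_def)
  moreover have "{} \<in> indeps (contraction M A)" using B by (simp add: iff)
  moreover have "indeps (contraction M A) \<subseteq> Pow (ground (contraction M A))"
    by (auto simp: contraction_def)
  ultimately show ?thesis by (intro matroidI) auto
qed

text \<open>With a basis \<open>B\<close> of \<open>A\<close> fixed, adding \<open>B\<close> carries
  independent sets of the contraction to those of \<open>M\<close>, and removing \<open>A\<close>
  from a largest extension of \<open>B\<close> in \<open>X Un A\<close> goes back. The additive form
  avoids truncated subtraction.\<close>

lemma rank_contraction:
  assumes "matroid M" "A \<subseteq> ground M" "X \<subseteq> ground M - A"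
  shows "rank (contraction M A) X + rank M A = rank M (X \<union> A)"
proof -
  obtain B where B: "B \<in> indeps M" "B \<subseteq> A" "card B = rank M A"
    using rank_attained[OF assms(1)] by blast
  note iff = contraction_indep_iff[OF assms(1,2) B]
  note mat = matroid_contraction[OF assms(1,2)]
  obtain I where I: "I \<in> indeps (contraction M A)" "I \<subseteq> X" "card I = rank (contraction M A) X"
    using rank_attained[OF mat] by blast
  have "card (I \<union> B) = card I + card B"
    using I B indep_finite[OF assms(1)] by (intro card_Un_disjoint) (auto simp: iff)
  moreover have "card (I \<union> B) \<le> rank M (X \<union> A)"
    using I B by (intro card_indep_le_rank[OF assms(1)]) (auto simp: iff)
  ultimately have le: "rank (contraction M A) X + rank M A \<le> rank M (X \<union> A)"
    using I B by simp
  obtain J where J: "J \<in> indeps M" "B \<subseteq> J" "J \<subseteq> X \<union> A" "card J = rank M (X \<union> A)"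
    using indep_extend_in[OF assms(1) B(1), of "X \<union> A"] B(2) by blast
  have finJ: "finite J" using J indep_finite[OF assms(1)] by blast
  have "card (J \<inter> A) \<le> rank M A"
    by (rule card_indep_le_rank[OF assms(1) indep_subset[OF assms(1) J(1)]]) auto
  moreover have "card J = card (J \<inter> A) + card (J - A)"
    using finJ by (metis card_Int_Diff)
  moreover have "card (J - A) \<le> rank (contraction M A) X"
    using J assms(3) indep_subset[OF assms(1) J(1), of "J - A \<union> B"]
    by (intro card_indep_le_rank[OF mat]) (auto simp: iff)
  ultimately show ?thesis using le J by linarith
qed

section \<open>Ranks in minors, duals and direct sums\<close>

lemma ground_minor: "ground (minor M G A) = G - A"
  by (simp add: minor_def contraction_def restriction_def)

lemma matroid_minor:
  assumes "matroid M" "A \<subseteq> G" "G \<subseteq> ground M"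
  shows "matroid (minor M G A)"
  unfolding minor_def
  by (rule matroid_contraction[OF matroid_restriction[OF assms(1,3)]])
    (simp add: restriction_def assms(2))

lemma rank_minor:
  assumes "matroid M" "A \<subseteq> G" "G \<subseteq> ground M" "X \<subseteq> G - A"
  shows "rank (minor M G A) X + rank M A = rank M (X \<union> A)"
proof -
  have "rank (minor M G A) X + rank (restriction M G) A = rank (restriction M G) (X \<union> A)"
    unfolding minor_def
    by (rule rank_contraction[OF matroid_restriction[OF assms(1,3)]])
      (simp_all add: restriction_def assms(2,4))
  then show ?thesis using assms rank_restriction[of A G M] rank_restriction[of "X \<union> A" G M] by auto
qed

text \<open>The dual rank of \<open>X\<close> is the largest size of \<open>X - B\<close> over bases
  \<open>B\<close>, so it is governed by the least number of elements that a basis has in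
  \<open>X\<close>. The two inequalities come from a basis with as many elements outside
  \<open>X\<close> as possible and from a basis avoiding a largest dual-independent subset of
  \<open>X\<close>.\<close>

lemma rank_dual:
  assumes "matroid M" "X \<subseteq> ground M"
  shows "rank (dual M) X + rank M (ground M) = card X + rank M (ground M - X)"
proof -
  let ?E = "ground M"
  have finX: "finite X" using assms matroid_finite_ground finite_subset by blast
  have fin: "finite {I \<in> indeps (dual M). I \<subseteq> X}"
    by (rule finite_subset[of _ "Pow X"]) (use finX in auto)
  obtain I0 where I0: "I0 \<in> indeps M" "I0 \<subseteq> ?E - X" "card I0 = rank M (?E - X)"
    using rank_attained[OF assms(1)] by blast
  \<comment> \<open>Starting from a largest independent set outside \<open>X\<close> keeps the
    intersection of \<open>B\<close> with \<open>X\<close> as small as possible;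
    \<open>X - B\<close> is then the witness for the dual rank.\<close>
  obtain B where B: "B \<in> indeps M" "I0 \<subseteq> B" "B \<subseteq> ?E" "card B = rank M ?E"
    using indep_extend_in[OF assms(1) I0(1), of ?E] I0(2) by blast
  have finB: "finite B" using B indep_finite[OF assms(1)] by blast
  have "rank M (?E - X) \<le> card (B - X)"
    unfolding I0(3)[symmetric] by (rule card_mono) (use finB B I0 in auto)
  moreover have "rank M ?E = card (B \<inter> X) + card (B - X)"
    using B finB by (metis card_Int_Diff)
  moreover have "card X = card (B \<inter> X) + card (X - B)"
    using finX by (metis card_Int_Diff inf_commute)
  moreover have "card (X - B) \<le> rank (dual M) X"
    unfolding rank_def
    using fin B assms
    by (intro Max_ge imageI) (auto simp: dual_def bases_iff_rank intro!: bexI[of _ B])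
  ultimately have ge: "card X + rank M (?E - X) \<le> rank (dual M) X + rank M ?E" by linarith
  have "{} \<in> indeps (dual M)" using B bases_iff_rank[OF assms(1)] by (auto simp: dual_def)
  then have "rank (dual M) X \<in> card ` {I \<in> indeps (dual M). I \<subseteq> X}"
    unfolding rank_def using fin by (intro Max_in) auto
  then obtain I C where I: "I \<subseteq> X" "card I = rank (dual M) X" and IC: "I \<inter> C = {}"
    and C: "C \<in> indeps M" "card C = rank M ?E"
    by (auto simp: dual_def bases_iff_rank[OF assms(1)])
  have finC: "finite C" using C indep_finite[OF assms(1)] by blast
  have "card (C - X) \<le> rank M (?E - X)"
    using C indep_subset[OF assms(1) C(1)] indep_subset_ground[OF assms(1) C(1)]
    by (intro card_indep_le_rank[OF assms(1)]) auto
  moreover have "card C = card (C \<inter> X) + card (C - X)"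
    using finC by (metis card_Int_Diff)
  moreover have "card (C \<inter> X) \<le> card (X - I)"
    by (rule card_mono) (use finX IC in auto)
  moreover have "card (X - I) = card X - card I" "card I \<le> card X"
    using card_Diff_subset[of I X] card_mono[of X I] I(1) finX finite_subset[of I X] by auto
  ultimately show ?thesis using ge C I by linarith
qed

text \<open>Because the ground sets are disjoint, an independent set inside \<open>X Un Y\<close>
  splits into parts inside \<open>X\<close> and inside \<open>Y\<close>, and the sizes add.\<close>

lemma rank_direct_sum:
  assumes "matroid M" "matroid N" "ground M \<inter> ground N = {}" "X \<subseteq> ground M" "Y \<subseteq> ground N"
  shows "rank (direct_sum M N) (X \<union> Y) = rank M X + rank N Y"
proof -
  have split: "card (I \<union> J) = card I + card J" if "I \<in> indeps M" "J \<in> indeps N" for I J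
    using indep_finite[OF assms(1) that(1)] indep_finite[OF assms(2) that(2)] assms(3)
      indep_subset_ground[OF assms(1) that(1)] indep_subset_ground[OF assms(2) that(2)]
    by (intro card_Un_disjoint) auto
  have fin: "finite {K \<in> indeps (direct_sum M N). K \<subseteq> X \<union> Y}"
    by (rule finite_subset[of _ "Pow (X \<union> Y)"])
      (use assms(4,5) matroid_finite_ground[OF assms(1)] matroid_finite_ground[OF assms(2)]
       in \<open>auto intro: finite_subset\<close>)
  obtain I where I: "I \<in> indeps M" "I \<subseteq> X" "card I = rank M X"
    using rank_attained[OF assms(1)] by blast
  obtain J where J: "J \<in> indeps N" "J \<subseteq> Y" "card J = rank N Y"
    using rank_attained[OF assms(2)] by blast
  show ?thesis
    unfolding rank_def[of "direct_sum M N"]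
  proof (rule Max_eqI)
    show "finite (card ` {K \<in> indeps (direct_sum M N). K \<subseteq> X \<union> Y})" using fin by simp
    have "I \<union> J \<in> {K \<in> indeps (direct_sum M N). K \<subseteq> X \<union> Y}"
      using I J by (auto simp: direct_sum_def)
    then show "rank M X + rank N Y \<in> card ` {K \<in> indeps (direct_sum M N). K \<subseteq> X \<union> Y}"
      by (rule rev_image_eqI) (simp add: split[OF I(1) J(1)] I(3) J(3))
    fix c assume "c \<in> card ` {K \<in> indeps (direct_sum M N). K \<subseteq> X \<union> Y}"
    then obtain I' J' where IJ: "I' \<in> indeps M" "J' \<in> indeps N" "I' \<union> J' \<subseteq> X \<union> Y" "c = card (I' \<union> J')"
      by (auto simp: direct_sum_def)
    then have "I' \<subseteq> X" "J' \<subseteq> Y"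
      using indep_subset_ground[OF assms(1) IJ(1)] indep_subset_ground[OF assms(2) IJ(2)] assms by blast+
    then show "c \<le> rank M X + rank N Y"
      using IJ split[OF IJ(1,2)] card_indep_le_rank[OF assms(1) IJ(1), of X]
        card_indep_le_rank[OF assms(2) IJ(2), of Y] by linarith
  qed
qed

section \<open>The beta invariant as an alternating sum\<close>

lemma varX_diff_one: "varX - 1 = [:[:-1, 1:]:]"
  by (simp add: varX_def one_pCons)

lemma varY_diff_one: "varY - 1 = [:-1, 1:]"
  by (simp add: varY_def one_pCons)

lemma coeff_0_power: "coeff (p ^ n) 0 = coeff (p :: 'a::comm_semiring_1 poly) 0 ^ n"
  by (induction n) (simp_all add: coeff_mult)

text \<open>The usual value n (-1)^(n-1), written without the exponent \<open>n - 1\<close>.\<close>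

lemma coeff_1_linear_power: "coeff ([:-1, 1:] ^ n :: int poly) 1 = - (int n * (-1) ^ n)"
proof (induction n)
  case (Suc n)
  have "coeff ([:-1, 1:] ^ Suc n :: int poly) 1 =
      coeff ([:-1, 1:] ^ n) 0 - coeff ([:-1, 1:] ^ n :: int poly) 1"
    by simp
  then show ?case using Suc by (simp add: coeff_0_power algebra_simps)
qed simp

lemma const_poly_power: "[:p:] ^ n = [:p ^ n :: 'a::comm_semiring_1:]"
  by (induction n) (simp_all add: one_pCons mult.commute)

text \<open>\<open>varX - 1\<close> is constant in y, so taking the y-constant coefficient only
  replaces \<open>varY - 1\<close> by -1; what remains is a linear coefficient in x.\<close>

lemma coeff_tutte_monomial:
  "coeff (coeff ((varX - 1) ^ m * (varY - 1) ^ n) 0) 1 = - (int m * (-1) ^ (m + n))"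
proof -
  have "coeff ((varX - 1) ^ m * (varY - 1) ^ n) 0 = [:-1, 1:] ^ m * (-1) ^ n"
    unfolding varX_diff_one varY_diff_one const_poly_power by (simp add: coeff_0_power)
  moreover have "coeff (p * (-1) ^ n) 1 = coeff p 1 * (-1) ^ n" for p :: "int poly"
    by (cases "even n") simp_all
  ultimately show ?thesis by (simp only: coeff_1_linear_power) (simp add: power_add)
qed

text \<open>The exponents differ by \<open>2 * r\<close>. For a Tutte summand this means that its
  sign depends on the size of the subset and on the total rank, but not on the rank of the
  subset.\<close>

lemma minus_one_power_add_sub:
  assumes "r \<le> c" "r \<le> R"
  shows "(-1 :: 'a::comm_ring_1) ^ (R - r + (c - r)) = (-1) ^ R * (-1) ^ c"
proof -
  have "R + c = (R - r + (c - r)) + 2 * r" using assms by simp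
  then have "(-1 :: 'a) ^ (R + c) = (-1) ^ ((R - r + (c - r)) + 2 * r)" by (rule arg_cong)
  then show ?thesis by (simp add: power_add power_mult)
qed

text \<open>Crapo's formula for the beta invariant, read off from the summands of
  \<open>tutte\<close>. The constant \<open>rank M (ground M)\<close> is kept here and cancels in
  \<open>beta_minor\<close>.\<close>

lemma beta_alternating:
  assumes "matroid M"
  shows "beta M = (-1) ^ rank M (ground M) *
    (\<Sum>A\<in>Pow (ground M). (-1) ^ card A * (int (rank M A) - int (rank M (ground M))))"
proof -
  let ?r = "rank M" and ?R = "rank M (ground M)"
  have "beta M = (\<Sum>A\<in>Pow (ground M). - (int (?R - ?r A) * (-1) ^ (?R - ?r A + (card A - ?r A))))"
    unfolding beta_def tutte_def by (simp only: coeff_sum coeff_tutte_monomial)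
  also have "\<dots> = (\<Sum>A\<in>Pow (ground M). (-1) ^ ?R * ((-1) ^ card A * (int (?r A) - int ?R)))"
  proof (rule sum.cong[OF refl])
    fix A assume A: "A \<in> Pow (ground M)"
    then have "finite A" using finite_subset matroid_finite_ground[OF assms] by auto
    then have "?r A \<le> card A" "?r A \<le> ?R"
      using A rank_le_card[OF assms] rank_mono[OF assms] by auto
    then show "- (int (?R - ?r A) * (-1) ^ (?R - ?r A + (card A - ?r A))) =
        (-1) ^ ?R * ((-1) ^ card A * (int (?r A) - int ?R))"
      by (simp only: minus_one_power_add_sub) (simp add: algebra_simps)
  qed
  finally show ?thesis by (simp add: sum_distrib_left)
qed

text \<open>By \<open>rank_dual\<close>, the corank of \<open>A\<close> in the dual is the nullity
  of its complement in \<open>M\<close>, and the nullity in the dual is the corank of the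
  complement. Summing over complements gives Crapo's formula with minus the nullity in place of the
  rank.\<close>

lemma beta_dual_alternating:
  assumes "matroid M"
  shows "beta_dual M = (-1) ^ rank M (ground M) *
    (\<Sum>A\<in>Pow (ground M). (-1) ^ card A * (int (rank M A) - int (card A)))"
proof -
  let ?E = "ground M" and ?r = "rank M" and ?R = "rank M (ground M)" and ?r' = "rank (dual M)"
  have g: "ground (dual M) = ?E" by (simp add: dual_def)
  have fin: "finite ?E" by (rule matroid_finite_ground[OF assms])
  have R': "?r' ?E + ?R = card ?E"
    using rank_dual[OF assms order_refl] by (simp add: rank_empty[OF assms])
  have "beta_dual M =
      (\<Sum>A\<in>Pow ?E. - (int (?r' ?E - ?r' A) * (-1) ^ (?r' ?E - ?r' A + (card A - ?r' A))))"
    unfolding beta_dual_def beta_def tutte_def g by (simp only: coeff_sum coeff_tutte_monomial)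
  also have "\<dots> = (\<Sum>A\<in>Pow ?E. (-1) ^ ?R * ((-1) ^ card (?E - A) * (int (?r (?E - A)) - int (card (?E - A)))))"
  proof (rule sum.cong[OF refl])
    fix A assume "A \<in> Pow ?E"
    then have A: "A \<subseteq> ?E" by simp
    then have cA: "card (?E - A) + card A = card ?E"
      using fin card_Diff_subset[of A ?E] card_mono[of ?E A] finite_subset[of A ?E] by auto
    have rA: "?r' A + ?R = card A + ?r (?E - A)" by (rule rank_dual[OF assms A])
    have le: "?r (?E - A) \<le> card (?E - A)" "?r (?E - A) \<le> ?R"
      using fin by (auto intro!: rank_le_card[OF assms] rank_mono[OF assms])
    have "?r' ?E - ?r' A = card (?E - A) - ?r (?E - A)" using R' cA rA le by linarith
    moreover have "card A - ?r' A = ?R - ?r (?E - A)" using rA le by linarith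
    ultimately show "- (int (?r' ?E - ?r' A) * (-1) ^ (?r' ?E - ?r' A + (card A - ?r' A))) =
        (-1) ^ ?R * ((-1) ^ card (?E - A) * (int (?r (?E - A)) - int (card (?E - A))))"
      using minus_one_power_add_sub[OF le, where 'a = int] le(1)
      by (simp add: algebra_simps)
  qed
  also have "\<dots> = (\<Sum>A\<in>Pow ?E. (-1) ^ ?R * ((-1) ^ card A * (int (?r A) - int (card A))))"
    by (rule sum.reindex_bij_witness[of _ "\<lambda>A. ?E - A" "\<lambda>A. ?E - A"]) auto
  finally show ?thesis by (simp add: sum_distrib_left)
qed

section \<open>Vanishing of beta and its dual on the excluded blocks\<close>

lemma sum_alternating_Pow:
  assumes "finite E" "E \<noteq> {}"
  shows "(\<Sum>A\<in>Pow E. (-1) ^ card A :: 'r::comm_ring_1) = 0"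
  using sum_alternating_set_interval[OF assms(1), of "{}"] assms(2)
  by (auto simp: Pow_def atLeastAtMost_def atLeast_def atMost_def)

text \<open>The sum over the union splits into two products, each with a factor that is the plain
  alternating sum over a nonempty set, hence zero.\<close>

lemma sum_alternating_additive:
  fixes f g h :: "'a set \<Rightarrow> int"
  assumes "finite E1" "finite E2" "E1 \<noteq> {}" "E2 \<noteq> {}" "E1 \<inter> E2 = {}"
    and "\<And>A B. A \<subseteq> E1 \<Longrightarrow> B \<subseteq> E2 \<Longrightarrow> f (A \<union> B) = g A + h B"
  shows "(\<Sum>A\<in>Pow (E1 \<union> E2). (-1) ^ card A * f A) = 0"
proof -
  have "(\<Sum>A\<in>Pow (E1 \<union> E2). (-1) ^ card A * f A) =
      (\<Sum>(A, B)\<in>Pow E1 \<times> Pow E2. (-1) ^ card A * (-1) ^ card B * (g A + h B))"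
  proof (rule sum.reindex_bij_witness[of _ "\<lambda>(A, B). A \<union> B" "\<lambda>C. (C \<inter> E1, C \<inter> E2)"])
    fix C assume "C \<in> Pow (E1 \<union> E2)"
    then have C: "C = (C \<inter> E1) \<union> (C \<inter> E2)" by auto
    then have "card C = card (C \<inter> E1) + card (C \<inter> E2)"
      using card_Un_disjoint[of "C \<inter> E1" "C \<inter> E2"] assms by auto
    moreover have "f C = g (C \<inter> E1) + h (C \<inter> E2)"
      by (subst C) (rule assms, auto)
    ultimately show "(case (C \<inter> E1, C \<inter> E2) of
        (A, B) \<Rightarrow> (-1) ^ card A * (-1) ^ card B * (g A + h B)) = (-1) ^ card C * f C"
      by (simp add: power_add)
  qed (use assms in auto)
  also have "\<dots> = (\<Sum>A\<in>Pow E1. (-1) ^ card A * g A) * (\<Sum>B\<in>Pow E2. (-1) ^ card B) +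
      (\<Sum>A\<in>Pow E1. (-1) ^ card A) * (\<Sum>B\<in>Pow E2. (-1) ^ card B * h B)"
    unfolding sum_product sum.cartesian_product
    by (simp add: sum.distrib[symmetric] split_def algebra_simps)
  also have "\<dots> = 0" using assms by (simp add: sum_alternating_Pow)
  finally show ?thesis .
qed

text \<open>Rank and cardinality are additive over the two summands, and so is the constant total
  rank; both alternating sums are therefore of the form treated in
  \<open>sum_alternating_additive\<close>.\<close>

lemma beta_disconnected:
  assumes "matroid M" "\<not> connected_matroid M"
  shows "beta M = 0" "beta_dual M = 0"
proof -
  obtain M1 M2 where m: "matroid M1" "matroid M2" "ground M1 \<noteq> {}" "ground M2 \<noteq> {}"
    "ground M1 \<inter> ground M2 = {}" and M: "M = direct_sum M1 M2"
    using assms(2) unfolding connected_matroid_def by blast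
  note fin = m(1,2)[THEN matroid_finite_ground]
  let ?E1 = "ground M1" and ?E2 = "ground M2"
  have g: "ground M = ?E1 \<union> ?E2" by (simp add: M direct_sum_def)
  have r: "rank M (A \<union> B) = rank M1 A + rank M2 B" if "A \<subseteq> ?E1" "B \<subseteq> ?E2" for A B
    unfolding M by (rule rank_direct_sum) (use m that in auto)
  have c: "card (A \<union> B) = card A + card B" if "A \<subseteq> ?E1" "B \<subseteq> ?E2" for A B
    by (rule card_Un_disjoint)
      (use m(5) that finite_subset[OF that(1) fin(1)] finite_subset[OF that(2) fin(2)] in auto)
  show "beta M = 0" unfolding beta_alternating[OF assms(1)] unfolding g
    by (subst sum_alternating_additive[OF fin m(3-5),
        of _ "\<lambda>A. int (rank M1 A) - int (rank M1 ?E1)" "\<lambda>A. int (rank M2 A) - int (rank M2 ?E2)"])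
      (use r in auto)
  show "beta_dual M = 0" unfolding beta_dual_alternating[OF assms(1)] unfolding g
    by (subst sum_alternating_additive[OF fin m(3-5),
        of _ "\<lambda>A. int (rank M1 A) - int (card A)" "\<lambda>A. int (rank M2 A) - int (card A)"])
      (use r c in auto)
qed

text \<open>The rank vanishes on both subsets of the ground set, so every summand is zero.\<close>

lemma beta_loop:
  assumes "matroid M" "is_loop M"
  shows "beta M = 0"
proof -
  obtain e where e: "ground M = {e}" "{e} \<notin> indeps M" using assms(2) unfolding is_loop_def by blast
  obtain I where I: "I \<in> indeps M" "I \<subseteq> {e}" "card I = rank M {e}"
    using rank_attained[OF assms(1)] by blast
  then have "I = {}" using e by (metis subset_singleton_iff)
  then have "rank M {e} = 0" using I by simp
  then show ?thesis unfolding beta_alternating[OF assms(1)] e by (simp add: Pow_insert rank_empty[OF assms(1)])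
qed

text \<open>The nullity vanishes on both subsets of the ground set, so every summand is
  zero.\<close>

lemma beta_dual_isthmus:
  assumes "matroid M" "is_isthmus M"
  shows "beta_dual M = 0"
proof -
  obtain e where e: "ground M = {e}" "{e} \<in> indeps M" using assms(2) unfolding is_isthmus_def by blast
  have "card {e} \<le> rank M {e}" by (rule card_indep_le_rank[OF assms(1) e(2)]) simp
  then have "rank M {e} = 1" using rank_le_card[OF assms(1), of "{e}"] by simp
  then show ?thesis unfolding beta_dual_alternating[OF assms(1)] e
    by (simp add: Pow_insert rank_empty[OF assms(1)])
qed

section \<open>Beta of minors as sums over intervals of sets\<close>

lemma bij_betw_minor_interval:
  assumes "A \<subseteq> G"
  shows "bij_betw (\<lambda>X. X - A) {A..G} (Pow (G - A))"
  by (rule bij_betw_byWitness[of _ "\<lambda>X. X \<union> A"]) (use assms in auto)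

lemma minor_interval_rank_card:
  assumes "matroid M" "G \<subseteq> ground M" "X \<in> {A..G}"
  shows "rank (minor M G A) (X - A) + rank M A = rank M X" "card (X - A) + card A = card X"
proof -
  have "X - A \<union> A = X" "A \<subseteq> G" "X - A \<subseteq> G - A" using assms(3) by auto
  then show "rank (minor M G A) (X - A) + rank M A = rank M X"
    using rank_minor[OF assms(1) _ assms(2)] by metis
  have "finite X"
    using assms(2,3) by (intro finite_subset[OF _ matroid_finite_ground[OF assms(1)]]) auto
  then show "card (X - A) + card A = card X"
    using assms(3) card_Diff_subset[of A X] card_mono[of X A] finite_subset[of A X] by auto
qed

text \<open>Subsets of \<open>G - A\<close> correspond to sets between \<open>A\<close> and
  \<open>G\<close>. The constant rank of \<open>G\<close> is multiplied by the alternating sum over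
  a proper interval and drops out. The sign is split into factors depending on \<open>A\<close> or
  on \<open>G\<close> alone, as the convolution sums require.\<close>

lemma beta_minor:
  fixes M :: "'a set_system"
  assumes "matroid M" "G \<subseteq> ground M" "A \<subset> G"
  shows "beta (minor M G A) = (-1) ^ rank M G * (-1) ^ rank M A * (-1) ^ card A *
    (\<Sum>X\<in>{A..G}. (-1) ^ card X * int (rank M X))"
proof -
  let ?N = "minor M G A"
  have AG: "A \<subseteq> G" using assms(3) by auto
  have finG: "finite G" using assms(2) matroid_finite_ground[OF assms(1)] finite_subset by blast
  note rc = minor_interval_rank_card[OF assms(1,2)]
  have G: "rank ?N (G - A) + rank M A = rank M G" using rc(1)[of G A] AG by simp
  \<comment> \<open>A difference of exponents becomes a product of signs because each sign squares
    to 1.\<close>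
  have sgn: "(-1) ^ rank ?N (G - A) = (-1) ^ rank M G * (-1 :: int) ^ rank M A"
    unfolding G[symmetric] by (simp add: power_add flip: power_mult_distrib)
  have "beta ?N = (-1) ^ rank ?N (G - A) *
      (\<Sum>X\<in>Pow (G - A). (-1) ^ card X * (int (rank ?N X) - int (rank ?N (G - A))))"
    using beta_alternating[OF matroid_minor[OF assms(1) AG assms(2)]] by (simp add: ground_minor)
  also have "(\<Sum>X\<in>Pow (G - A). (-1) ^ card X * (int (rank ?N X) - int (rank ?N (G - A)))) =
      (\<Sum>X\<in>{A..G}. (-1) ^ card (X - A) * (int (rank ?N (X - A)) - int (rank ?N (G - A))))"
    by (rule sum.reindex_bij_betw[OF bij_betw_minor_interval[OF AG], symmetric])
  also have "\<dots> = (\<Sum>X\<in>{A..G}. (-1) ^ card A * ((-1) ^ card X * int (rank M X)) -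
      (-1) ^ card A * ((-1) ^ card X * int (rank M G)))"
  proof (rule sum.cong[OF refl])
    fix X assume X: "X \<in> {A..G}"
    have "(-1) ^ card (X - A) = (-1) ^ card A * (-1 :: int) ^ card X"
      unfolding rc(2)[OF X, symmetric] by (simp add: power_add flip: power_mult_distrib)
    moreover have "int (rank ?N (X - A)) - int (rank ?N (G - A)) = int (rank M X) - int (rank M G)"
      using rc(1)[OF X] G by linarith
    ultimately show "(-1) ^ card (X - A) * (int (rank ?N (X - A)) - int (rank ?N (G - A))) =
        (-1) ^ card A * ((-1) ^ card X * int (rank M X)) -
        (-1) ^ card A * ((-1) ^ card X * int (rank M G))"
      by (simp add: right_diff_distrib mult.assoc)
  qed
  also have "\<dots> = (-1) ^ card A * (\<Sum>X\<in>{A..G}. (-1) ^ card X * int (rank M X)) -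
      (-1) ^ card A * ((\<Sum>X\<in>{A..G}. (-1) ^ card X) * int (rank M G))"
    by (simp add: sum_subtractf sum_distrib_left sum_distrib_right)
  finally show ?thesis
    using assms(3) by (simp add: sgn sum_alternating_set_interval[OF finG] mult.assoc)
qed

text \<open>As for \<open>beta_minor\<close>; the constant that drops out is now
  \<open>rank M A\<close> minus \<open>card A\<close>, by which passing to the minor shifts rank
  minus cardinality.\<close>

lemma beta_dual_minor:
  fixes M :: "'a set_system"
  assumes "matroid M" "G \<subseteq> ground M" "A \<subset> G"
  shows "beta_dual (minor M G A) = (-1) ^ rank M G * (-1) ^ rank M A * (-1) ^ card A *
    (\<Sum>X\<in>{A..G}. (-1) ^ card X * (int (rank M X) - int (card X)))"
proof -
  let ?N = "minor M G A"
  have AG: "A \<subseteq> G" using assms(3) by auto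
  have finG: "finite G" using assms(2) matroid_finite_ground[OF assms(1)] finite_subset by blast
  note rc = minor_interval_rank_card[OF assms(1,2)]
  have G: "rank ?N (G - A) + rank M A = rank M G" using rc(1)[of G A] AG by simp
  have sgn: "(-1) ^ rank ?N (G - A) = (-1) ^ rank M G * (-1 :: int) ^ rank M A"
    unfolding G[symmetric] by (simp add: power_add flip: power_mult_distrib)
  have "beta_dual ?N = (-1) ^ rank ?N (G - A) *
      (\<Sum>X\<in>Pow (G - A). (-1) ^ card X * (int (rank ?N X) - int (card X)))"
    using beta_dual_alternating[OF matroid_minor[OF assms(1) AG assms(2)]] by (simp add: ground_minor)
  also have "(\<Sum>X\<in>Pow (G - A). (-1) ^ card X * (int (rank ?N X) - int (card X))) =
      (\<Sum>X\<in>{A..G}. (-1) ^ card (X - A) * (int (rank ?N (X - A)) - int (card (X - A))))"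
    by (rule sum.reindex_bij_betw[OF bij_betw_minor_interval[OF AG], symmetric])
  also have "\<dots> = (\<Sum>X\<in>{A..G}. (-1) ^ card A * ((-1) ^ card X * (int (rank M X) - int (card X))) -
      (-1) ^ card A * ((-1) ^ card X * (int (rank M A) - int (card A))))"
  proof (rule sum.cong[OF refl])
    fix X assume X: "X \<in> {A..G}"
    have "(-1) ^ card (X - A) = (-1) ^ card A * (-1 :: int) ^ card X"
      unfolding rc(2)[OF X, symmetric] by (simp add: power_add flip: power_mult_distrib)
    moreover have "int (rank ?N (X - A)) - int (card (X - A)) =
        (int (rank M X) - int (card X)) - (int (rank M A) - int (card A))"
      using rc[OF X] by linarith
    ultimately show "(-1) ^ card (X - A) * (int (rank ?N (X - A)) - int (card (X - A))) =
        (-1) ^ card A * ((-1) ^ card X * (int (rank M X) - int (card X))) -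
        (-1) ^ card A * ((-1) ^ card X * (int (rank M A) - int (card A)))"
      by (simp only: right_diff_distrib mult.assoc)
  qed
  also have "\<dots> = (-1) ^ card A * (\<Sum>X\<in>{A..G}. (-1) ^ card X * (int (rank M X) - int (card X))) -
      (-1) ^ card A * ((\<Sum>X\<in>{A..G}. (-1) ^ card X) * (int (rank M A) - int (card A)))"
    by (simp only: sum_subtractf sum_distrib_left sum_distrib_right)
  finally show ?thesis
    using assms(3) by (simp add: sgn sum_alternating_set_interval[OF finG] mult.assoc)
qed

section \<open>Convolution and recursion formulas\<close>

text \<open>
  \<open>upper_sum M A\<close> is the Tutte polynomial of \<open>M/A\<close> at \<open>y = 0\<close>, and \<open>lower_sum M G\<close> that of
  \<open>M(G)\<close> at \<open>x = 0\<close>.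
\<close>

definition upper_sum :: "'a set_system \<Rightarrow> 'a set \<Rightarrow> int poly poly" where
  "upper_sum M A = (-1) ^ card A * (-1) ^ rank M A * (\<Sum>X\<in>{A..ground M}.
     (-1) ^ card X * (-1) ^ rank M (ground M) * (1 - varX) ^ (rank M (ground M) - rank M X))"

definition lower_sum :: "'a set_system \<Rightarrow> 'a set \<Rightarrow> int poly poly" where
  "lower_sum M G = (-1) ^ rank M G *
     (\<Sum>X\<in>{{}..G}. (-1) ^ card X * (1 - varY) ^ (card X - rank M X))"

lemma upper_sum_ground: "matroid M \<Longrightarrow> upper_sum M (ground M) = 1"
  by (simp add: upper_sum_def ac_simps)

lemma lower_sum_empty: "matroid M \<Longrightarrow> lower_sum M {} = 1"
  by (simp add: lower_sum_def rank_empty)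

text \<open>The convolution formula for the Tutte polynomial. In each product the two signs from
  \<open>rank M F\<close> cancel and only the sign of \<open>card F\<close> stays, so the double sum
  collapses to its diagonal, which is the corank-nullity expansion.\<close>

lemma tutte_convolution:
  assumes "matroid M"
  shows "tutte M = (\<Sum>F\<in>{{}..ground M}. lower_sum M F * upper_sum M F)"
proof -
  let ?E = "ground M" and ?r = "rank M" and ?R = "rank M (ground M)"
  define a where "a X = (-1) ^ card X * (1 - varY) ^ (card X - ?r X)" for X
  define b where "b X = (-1) ^ card X * (-1) ^ ?R * (1 - varX) ^ (?R - ?r X)" for X
  have Pow_eq: "Pow ?E = {{}..?E}" by auto
  have fin: "finite ?E" by (rule matroid_finite_ground[OF assms])
  have "lower_sum M F * upper_sum M F =
      (-1) ^ card F * (\<Sum>X\<in>{{}..F}. a X) * (\<Sum>Y\<in>{F..?E}. b Y)" for F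
    unfolding lower_sum_def upper_sum_def a_def[symmetric] b_def[symmetric]
    by (simp add: ac_simps)
  then have "(\<Sum>F\<in>{{}..?E}. lower_sum M F * upper_sum M F) =
      (\<Sum>X\<in>{{}..?E}. (-1) ^ card X * a X * b X)"
    using sum_alternating_convolution_full[OF fin, where A = "{}" and a = a and b = b] by simp
  also have "\<dots> = (\<Sum>X\<in>{{}..?E}. (varX - 1) ^ (?R - ?r X) * (varY - 1) ^ (card X - ?r X))"
  proof (rule sum.cong[OF refl])
    fix X assume X: "X \<in> {{}..?E}"
    then have "finite X" using fin finite_subset by auto
    then have le: "?r X \<le> card X" "?r X \<le> ?R"
      using X rank_le_card[OF assms] rank_mono[OF assms] by auto
    have neg: "(u - 1) ^ n = (-1) ^ n * (1 - u) ^ n" for u :: "int poly poly" and n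
      by (simp flip: power_mult_distrib)
    have "(varX - 1) ^ (?R - ?r X) * (varY - 1) ^ (card X - ?r X) =
        (-1) ^ (?R - ?r X + (card X - ?r X)) *
        ((1 - varX) ^ (?R - ?r X) * (1 - varY) ^ (card X - ?r X))"
      unfolding neg[of varX] neg[of varY] power_add by (simp only: ac_simps)
    then show "(-1) ^ card X * a X * b X = (varX - 1) ^ (?R - ?r X) * (varY - 1) ^ (card X - ?r X)"
      unfolding minus_one_power_add_sub[OF le] a_def b_def
      by (simp add: ac_simps)
  qed
  finally show ?thesis unfolding tutte_def Pow_eq by simp
qed

lemma rank_insert_cases:
  assumes "matroid M"
  obtains "rank M (insert p X) = rank M X" | "rank M (insert p X) = Suc (rank M X)"
  using rank_insert_le[OF assms, of p X] rank_mono[OF assms, of X "insert p X"]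
  by (auto simp: le_Suc_eq dest: antisym)

text \<open>Collapsing the sum over \<open>F\<close> leaves, for each \<open>X\<close> without
  \<open>p\<close>, the rank increment caused by \<open>p\<close> times
  \<open>b (insert p X)\<close>. Writing \<open>varX\<close> as \<open>1 - (1 - varX)\<close> turns
  this into \<open>b X + b (insert p X)\<close>, so the pairs add up to the whole sum. Any
  \<open>p\<close> outside \<open>A\<close> is allowed; the minimum is chosen later.\<close>

lemma upper_sum_recursion:
  assumes "matroid M" "p \<in> ground M - A" "A \<subseteq> ground M"
  shows "upper_sum M A =
    varX * (\<Sum>F\<in>{insert p A..ground M}. of_int (beta (minor M F A)) * upper_sum M F)"
proof -
  let ?E = "ground M" and ?r = "rank M" and ?R = "rank M (ground M)"
  define a :: "'a set \<Rightarrow> int poly poly" where "a X = (-1) ^ card X * of_nat (?r X)" for X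
  define b where "b X = (-1) ^ card X * (-1) ^ ?R * (1 - varX) ^ (?R - ?r X)" for X
  have fin: "finite ?E" by (rule matroid_finite_ground[OF assms(1)])
  have "(\<Sum>F\<in>{insert p A..?E}. of_int (beta (minor M F A)) * upper_sum M F) =
      (\<Sum>F\<in>{insert p A..?E}. (-1) ^ card A * (-1) ^ ?r A *
        ((-1) ^ card F * (\<Sum>X\<in>{A..F}. a X) * (\<Sum>Y\<in>{F..?E}. b Y)))"
  proof (rule sum.cong[OF refl])
    fix F assume F: "F \<in> {insert p A..?E}"
    have "of_int (beta (minor M F A)) =
        (-1) ^ ?r F * (-1) ^ ?r A * (-1) ^ card A * (\<Sum>X\<in>{A..F}. a X)"
      by (subst beta_minor[OF assms(1)]) (use F assms in \<open>auto simp: a_def\<close>)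
    then show "of_int (beta (minor M F A)) * upper_sum M F = (-1) ^ card A * (-1) ^ ?r A *
        ((-1) ^ card F * (\<Sum>X\<in>{A..F}. a X) * (\<Sum>Y\<in>{F..?E}. b Y))"
      unfolding upper_sum_def b_def[symmetric] by (simp add: ac_simps)
  qed
  also have "\<dots> = (-1) ^ card A * (-1) ^ ?r A *
      (\<Sum>X\<in>{A..?E - {p}}. - ((-1) ^ card X * (a X + a (insert p X)) * b (insert p X)))"
    by (simp only: sum_distrib_left[symmetric] sum_alternating_convolution_mem[OF fin assms(2)])
  finally have "varX * (\<Sum>F\<in>{insert p A..?E}. of_int (beta (minor M F A)) * upper_sum M F) =
      (-1) ^ card A * (-1) ^ ?r A *
      (\<Sum>X\<in>{A..?E - {p}}. varX * - ((-1) ^ card X * (a X + a (insert p X)) * b (insert p X)))"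
    by (simp only: sum_distrib_left[symmetric] mult.left_commute)
  also have "(\<Sum>X\<in>{A..?E - {p}}. varX * - ((-1) ^ card X * (a X + a (insert p X)) * b (insert p X))) =
      (\<Sum>X\<in>{A..?E - {p}}. b X + b (insert p X))"
  proof (rule sum.cong[OF refl])
    fix X assume X: "X \<in> {A..?E - {p}}"
    note c = card_insert_set_interval[OF fin X]
    have R: "?r (insert p X) \<le> ?R" using X assms by (intro rank_mono) auto
    show "varX * - ((-1) ^ card X * (a X + a (insert p X)) * b (insert p X)) = b X + b (insert p X)"
    proof (cases rule: rank_insert_cases[OF assms(1), of p X])
      \<comment> \<open>If \<open>p\<close> leaves the rank unchanged, both sides are zero: the
        \<open>a\<close>-values cancel, and so do the \<open>b\<close>-values.\<close>
      case 1
      then show ?thesis by (simp add: a_def b_def c)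
    next
      case 2
      then have "?R - ?r X = Suc (?R - ?r (insert p X))" using R by simp
      then show ?thesis using 2
        by (simp add: a_def b_def c algebra_simps)
    qed
  qed
  also have "\<dots> = (\<Sum>X\<in>{A..?E}. b X)"
    by (rule sum_set_interval_split[OF fin assms(2), symmetric])
  finally show ?thesis by (simp add: upper_sum_def b_def)
qed

text \<open>The mirror of \<open>upper_sum_recursion\<close>: \<open>F\<close> avoids
  \<open>p\<close> instead of containing it, and the nullity increment replaces the rank increment.
  It is nonzero exactly when \<open>p\<close> does not raise the rank, so the two cases change
  roles.\<close>

lemma lower_sum_recursion:
  assumes "matroid M" "p \<in> G" "G \<subseteq> ground M"
  shows "lower_sum M G =
    varY * (\<Sum>F\<in>{{}..G - {p}}. of_int (beta_dual (minor M G F)) * lower_sum M F)"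
proof -
  let ?r = "rank M"
  define a where "a X = (-1) ^ card X * (1 - varY) ^ (card X - ?r X)" for X
  define b :: "'a set \<Rightarrow> int poly poly" where
    "b X = (-1) ^ card X * (of_nat (?r X) - of_nat (card X))" for X
  have fin: "finite G" using matroid_finite_ground[OF assms(1)] assms(3) finite_subset by blast
  have p: "p \<in> G - {}" using assms(2) by simp
  have "(\<Sum>F\<in>{{}..G - {p}}. of_int (beta_dual (minor M G F)) * lower_sum M F) =
      (\<Sum>F\<in>{{}..G - {p}}. (-1) ^ ?r G *
        ((-1) ^ card F * (\<Sum>X\<in>{{}..F}. a X) * (\<Sum>Y\<in>{F..G}. b Y)))"
  proof (rule sum.cong[OF refl])
    fix F assume F: "F \<in> {{}..G - {p}}"
    have "of_int (beta_dual (minor M G F)) =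
        (-1) ^ ?r G * (-1) ^ ?r F * (-1) ^ card F * (\<Sum>X\<in>{F..G}. b X)"
      by (subst beta_dual_minor[OF assms(1)]) (use F assms in \<open>auto simp: b_def\<close>)
    then show "of_int (beta_dual (minor M G F)) * lower_sum M F = (-1) ^ ?r G *
        ((-1) ^ card F * (\<Sum>X\<in>{{}..F}. a X) * (\<Sum>Y\<in>{F..G}. b Y))"
      unfolding lower_sum_def a_def[symmetric] by (simp add: ac_simps)
  qed
  also have "\<dots> = (-1) ^ ?r G *
      (\<Sum>X\<in>{{}..G - {p}}. (-1) ^ card X * a X * (b X + b (insert p X)))"
    by (simp only: sum_distrib_left[symmetric] sum_alternating_convolution_not_mem[OF fin p])
  finally have "varY * (\<Sum>F\<in>{{}..G - {p}}. of_int (beta_dual (minor M G F)) * lower_sum M F) =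
      (-1) ^ ?r G * (\<Sum>X\<in>{{}..G - {p}}. varY * ((-1) ^ card X * a X * (b X + b (insert p X))))"
    by (simp only: sum_distrib_left[symmetric] mult.left_commute)
  also have "(\<Sum>X\<in>{{}..G - {p}}. varY * ((-1) ^ card X * a X * (b X + b (insert p X)))) =
      (\<Sum>X\<in>{{}..G - {p}}. a X + a (insert p X))"
  proof (rule sum.cong[OF refl])
    fix X assume X: "X \<in> {{}..G - {p}}"
    note c = card_insert_set_interval[OF fin X]
    have r: "?r X \<le> card X" using X fin by (intro rank_le_card[OF assms(1)]) (auto intro: finite_subset)
    show "varY * ((-1) ^ card X * a X * (b X + b (insert p X))) = a X + a (insert p X)"
    proof (cases rule: rank_insert_cases[OF assms(1), of p X])
      case 1
      then have "card (insert p X) - ?r (insert p X) = Suc (card X - ?r X)" using r c by simp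
      then show ?thesis using 1
        by (simp add: a_def b_def c algebra_simps)
    next
      case 2
      then show ?thesis by (simp add: a_def b_def c)
    qed
  qed
  also have "\<dots> = (\<Sum>X\<in>{{}..G}. a X)"
    by (rule sum_set_interval_split[OF fin p, symmetric])
  finally show ?thesis by (simp add: lower_sum_def a_def)
qed

section \<open>Chains of sets with increasing block minima\<close>

text \<open>The upper part of a filtration, with a free starting set \<open>A\<close> so that the
  tail of a chain is again a chain.\<close>

definition up_chain :: "'a::linorder set \<Rightarrow> 'a set \<Rightarrow> 'a set list \<Rightarrow> bool" where
  "up_chain E A L \<longleftrightarrow> L \<noteq> [] \<and> hd L = A \<and> last L = E \<and>
     (\<forall>k\<in>{1..length L - 1}. L ! (k - 1) \<subset> L ! k) \<and>
     strict_mono_on {1..length L - 1} (\<lambda>k. Min (L ! k - L ! (k - 1)))"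

text \<open>The lower part of a filtration, listed from the cyclic end \<open>G\<close> downwards as
  in \<open>filtration\<close>.\<close>

definition down_chain :: "'a::linorder set \<Rightarrow> 'a set list \<Rightarrow> bool" where
  "down_chain G L \<longleftrightarrow> L \<noteq> [] \<and> hd L = G \<and> last L = {} \<and>
     (\<forall>k\<in>{1..length L - 1}. L ! k \<subset> L ! (k - 1)) \<and>
     strict_mono_on {1..length L - 1} (\<lambda>k. Min (L ! (k - 1) - L ! k))"

lemma ball_1_atMost_Suc: "(\<forall>k\<in>{1..Suc n}. P k) \<longleftrightarrow> P 1 \<and> (\<forall>k\<in>{1..n}. P (Suc k))"
proof -
  have eq: "{1..Suc n} = insert 1 (Suc ` {1..n})"
    by (auto simp: image_iff)
  show ?thesis by (subst eq) blast
qed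

lemma strict_mono_on_1_atMost_Suc:
  fixes f :: "nat \<Rightarrow> 'a::linorder"
  shows "strict_mono_on {1..Suc n} f \<longleftrightarrow>
    (\<forall>k\<in>{1..n}. f 1 < f (Suc k)) \<and> strict_mono_on {1..n} (\<lambda>k. f (Suc k))" (is "?l \<longleftrightarrow> ?r")
proof
  show ?r if ?l using that by (auto simp: strict_mono_on_def)
next
  assume r: ?r
  show ?l
  proof (rule strict_mono_onI)
    fix i j assume "i \<in> {1..Suc n}" "j \<in> {1..Suc n}" "i < j"
    then obtain j' where j: "j = Suc j'" "j' \<in> {1..n}" by (cases j) auto
    show "f i < f j"
    proof (cases "i = 1")
      case True
      then show ?thesis using r j by auto
    next
      case False
      then obtain i' where "i = Suc i'" "i' \<in> {1..n}"
        using \<open>i \<in> {1..Suc n}\<close> by (cases i) auto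
      then show ?thesis using r j \<open>i < j\<close> by (auto simp: strict_mono_on_def)
    qed
  qed
qed

lemma up_chain_singleton: "up_chain E A [B] \<longleftrightarrow> A = B \<and> B = E"
  by (auto simp: up_chain_def)

lemma up_chain_Cons_Cons:
  "up_chain E A (B # C # L) \<longleftrightarrow> A = B \<and> A \<subset> C \<and> up_chain E C (C # L) \<and>
     (\<forall>k\<in>{1..length L}. Min (C - A) < Min ((C # L) ! k - (C # L) ! (k - 1)))"
proof -
  let ?f = "\<lambda>k. (C # L) ! k - (C # L) ! (k - 1)"
  let ?g = "\<lambda>k. (B # C # L) ! k - (B # C # L) ! (k - 1)"
  have shift: "(B # C # L) ! Suc k = (C # L) ! k" "(B # C # L) ! (Suc k - 1) = (C # L) ! (k - 1)"
    if "k \<in> {1..length L}" for k using that by (cases k; simp)+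
  have sub: "(\<forall>k\<in>{1..length (B # C # L) - 1}. (B # C # L) ! (k - 1) \<subset> (B # C # L) ! k) \<longleftrightarrow>
      B \<subset> C \<and> (\<forall>k\<in>{1..length (C # L) - 1}. (C # L) ! (k - 1) \<subset> (C # L) ! k)"
    using ball_1_atMost_Suc[of "length L" "\<lambda>k. (B # C # L) ! (k - 1) \<subset> (B # C # L) ! k"] shift
    by simp
  have "?g 1 = C - B" by simp
  moreover have g: "?g (Suc k) = ?f k" if "k \<in> {1..length L}" for k
    by (simp only: shift[OF that])
  ultimately have "strict_mono_on {1..length (B # C # L) - 1} (\<lambda>k. Min (?g k)) \<longleftrightarrow>
      (\<forall>k\<in>{1..length L}. Min (C - B) < Min (?f k)) \<and>
      strict_mono_on {1..length L} (\<lambda>k. Min (?g (Suc k)))"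
    using strict_mono_on_1_atMost_Suc[of "length L" "\<lambda>k. Min (?g k)"] by simp
  also have "strict_mono_on {1..length L} (\<lambda>k. Min (?g (Suc k))) \<longleftrightarrow>
      strict_mono_on {1..length (C # L) - 1} (\<lambda>k. Min (?f k))"
    unfolding strict_mono_on_def using g by simp
  finally show ?thesis unfolding up_chain_def sub by auto
qed

lemma up_chain_members: "up_chain E A L \<Longrightarrow> X \<in> set L \<Longrightarrow> A \<subseteq> X \<and> X \<subseteq> E"
proof (induction L arbitrary: A X)
  case Nil
  then show ?case by simp
next
  case (Cons B L)
  show ?case
  proof (cases L)
    case Nil
    then show ?thesis using Cons.prems by (auto simp: up_chain_singleton)
  next
    case (Cons C L')
    then have c: "A = B" "A \<subset> C" "up_chain E C L"
      using Cons.prems(1) by (auto simp: up_chain_Cons_Cons)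
    then have "C \<subseteq> Y \<and> Y \<subseteq> E" if "Y \<in> set L" for Y using Cons.IH that by blast
    then show ?thesis using c Cons.prems(2) \<open>L = C # L'\<close> by fastforce
  qed
qed

lemma up_chain_subset: "up_chain E A L \<Longrightarrow> A \<subseteq> E"
  using up_chain_members[of E A L A] by (auto simp: up_chain_def)

text \<open>Since block minima increase, the first block contains the least of all remaining
  elements.\<close>

lemma up_chain_Min:
  assumes "finite E" "up_chain E A (A # C # L)"
  shows "Min (E - A) = Min (C - A)"
  using assms(2)
proof (induction L arbitrary: A C)
  case Nil
  then show ?case by (auto simp: up_chain_Cons_Cons up_chain_singleton)
next
  case (Cons D L)
  then have c: "A \<subset> C" "up_chain E C (C # D # L)"
    and "\<forall>k\<in>{1..Suc (length L)}. Min (C - A) < Min ((C # D # L) ! k - (C # D # L) ! (k - 1))"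
    by (simp_all add: up_chain_Cons_Cons[of E A])
  then have "Min (C - A) < Min (D - C)" by (force dest: bspec[of _ _ 1])
  then have less: "Min (C - A) < Min (E - C)" using Cons.IH[OF c(2)] by simp
  have "C \<subset> D" "up_chain E D (D # L)" using c(2) by (auto simp: up_chain_Cons_Cons[of E C])
  then have sub: "C \<subset> E" using up_chain_subset by blast
  have eq: "E - A = (C - A) \<union> (E - C)" using c(1) sub by auto
  have "finite (C - A)" "C - A \<noteq> {}" "finite (E - C)" "E - C \<noteq> {}"
    using assms(1) sub c(1) finite_subset[of C E] by auto
  then show ?case unfolding eq using less by (simp add: Min_Un)
qed

text \<open>The comparison of the first block with all later ones becomes a single membership that
  does not mention the rest of the chain. This local form is what allows chains to be summed
  recursively.\<close>

lemma up_chain_Cons: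
  assumes "finite E"
  shows "up_chain E A (B # C # L) \<longleftrightarrow> A = B \<and> A \<subset> C \<and> Min (E - A) \<in> C \<and> up_chain E C (C # L)"
proof
  assume chain: "up_chain E A (B # C # L)"
  then have c: "A = B" "A \<subset> C" "up_chain E C (C # L)" by (auto simp: up_chain_Cons_Cons)
  have "finite (C - A)" using assms up_chain_subset[OF c(3)] finite_subset by blast
  then have "Min (C - A) \<in> C - A" using c(2) by (intro Min_in) auto
  then show "A = B \<and> A \<subset> C \<and> Min (E - A) \<in> C \<and> up_chain E C (C # L)"
    using c up_chain_Min[OF assms, of A C L] chain by simp
next
  assume c: "A = B \<and> A \<subset> C \<and> Min (E - A) \<in> C \<and> up_chain E C (C # L)"
  then have CE: "C \<subseteq> E" using up_chain_subset by blast
  let ?m = "Min (E - A)"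
  have fin: "finite (E - A)" using assms by simp
  have "?m \<in> E - A" using c CE by (intro Min_in[OF fin]) auto
  then have "Min (C - A) = ?m"
    using c CE fin finite_subset[OF CE assms] by (intro Min_eqI) (auto intro: Min_le)
  \<comment> \<open>The later block minima are at least the first of them, which is
    \<open>Min (E - C)\<close>; this differs from \<open>?m\<close> because \<open>?m\<close> lies
    in \<open>C\<close>.\<close>
  moreover have "?m < Min ((C # L) ! k - (C # L) ! (k - 1))" if k: "k \<in> {1..length L}" for k
  proof -
    obtain D L' where L: "L = D # L'" using k by (cases L) auto
    have sm: "strict_mono_on {1..length L} (\<lambda>k. Min ((C # L) ! k - (C # L) ! (k - 1)))"
      using c by (simp add: up_chain_def)
    have "Min (E - C) = Min (D - C)" by (rule up_chain_Min[OF assms]) (use c L in auto)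
    also have "\<dots> = Min ((C # L) ! 1 - (C # L) ! (1 - 1))" by (simp add: L)
    also have "\<dots> \<le> Min ((C # L) ! k - (C # L) ! (k - 1))"
      using strict_mono_on_leD[OF sm, of 1 k] k by simp
    finally have le: "Min (E - C) \<le> Min ((C # L) ! k - (C # L) ! (k - 1))" .
    have "C \<subset> D" "up_chain E D (D # L')" using c L by (auto simp: up_chain_Cons_Cons)
    then have "C \<subset> E" using up_chain_subset by blast
    then have "Min (E - C) \<in> E - C" using assms by (intro Min_in) auto
    then have "?m \<le> Min (E - C)" "?m \<noteq> Min (E - C)" using c fin by (auto intro!: Min_le)
    then show ?thesis using le by simp
  qed
  ultimately show "up_chain E A (B # C # L)" using c by (auto simp: up_chain_Cons_Cons)
qed

lemma up_chain_refl: "{L. up_chain E E L} = {[E]}"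
proof -
  have "L = [E]" if L: "up_chain E E L" for L
  proof -
    obtain B L' where eq: "L = B # L'"
      using L unfolding up_chain_def by (meson neq_Nil_conv)
    show ?thesis
    proof (cases L')
      case Nil
      then have "B = E" using L unfolding eq Nil up_chain_singleton by blast
      then show ?thesis using eq Nil by simp
    next
      case (Cons C L'')
      then have "E \<subset> C" "up_chain E C (C # L'')"
        using L unfolding eq Cons up_chain_Cons_Cons by blast+
      then show ?thesis using up_chain_subset by blast
    qed
  qed
  moreover have "up_chain E E [E]" by (simp add: up_chain_singleton)
  ultimately show ?thesis by blast
qed

text \<open>Chains are sorted by their second set \<open>C\<close>. Its range is exactly the range
  of summation in \<open>upper_sum_recursion\<close> for \<open>p = Min (E - A)\<close>; properness
  of the first step is automatic because that minimum is not in \<open>A\<close>.\<close>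

lemma up_chain_Union:
  assumes "finite E" "A \<subset> E"
  shows "{L. up_chain E A L} = (\<Union>C\<in>{insert (Min (E - A)) A..E}. (#) A ` {L. up_chain E C L})"
proof -
  have m: "Min (E - A) \<in> E - A" using assms by (intro Min_in) auto
  have hd: "L = C # tl L" if "up_chain E C L" for C L
    using that by (auto simp: up_chain_def)
  show ?thesis
  proof (intro equalityI subsetI)
    fix L assume "L \<in> {L. up_chain E A L}"
    then have L: "up_chain E A L" by simp
    then obtain C L' where eq: "L = A # C # L'"
      using assms(2) hd[OF L] by (cases "tl L") (auto simp: up_chain_def split: if_splits)
    have c: "A \<subset> C" "Min (E - A) \<in> C" "up_chain E C (C # L')"
      using L unfolding eq up_chain_Cons[OF assms(1)] by auto
    then have "C \<in> {insert (Min (E - A)) A..E}" using up_chain_subset by auto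
    then show "L \<in> (\<Union>C\<in>{insert (Min (E - A)) A..E}. (#) A ` {L. up_chain E C L})"
      using c eq by blast
  next
    fix L assume "L \<in> (\<Union>C\<in>{insert (Min (E - A)) A..E}. (#) A ` {L. up_chain E C L})"
    then obtain C L' where C: "insert (Min (E - A)) A \<subseteq> C" "L = A # L'" "up_chain E C L'" by auto
    then have "A \<subset> C" "L = A # C # tl L'" "up_chain E C (C # tl L')" using m hd by auto
    then show "L \<in> {L. up_chain E A L}" using C(1) by (simp add: up_chain_Cons[OF assms(1)])
  qed
qed

section \<open>Weighted sums over chains\<close>

text \<open>The first argument of \<open>w\<close> is the earlier set in the list, whichever of the
  two is larger, so one definition serves increasing and decreasing chains.\<close>

definition chain_weight :: "('a set \<Rightarrow> 'a set \<Rightarrow> 'r::comm_ring_1) \<Rightarrow> 'r \<Rightarrow> 'a set list \<Rightarrow> 'r" where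
  "chain_weight w c L = (\<Prod>k = 1..length L - 1. w (L ! (k - 1)) (L ! k)) * c ^ (length L - 1)"

lemma chain_weight_Cons:
  assumes "up_chain E C L"
  shows "chain_weight w c (A # L) = c * (w A C * chain_weight w c L)"
proof -
  obtain L' where L: "L = C # L'" using assms by (cases L) (auto simp: up_chain_def)
  let ?f = "\<lambda>k. w ((A # C # L') ! (k - 1)) ((A # C # L') ! k)"
  have "(\<Prod>k = 1..Suc (length L'). ?f k) = ?f 1 * (\<Prod>k = Suc 1..Suc (length L'). ?f k)"
    by (rule prod.atLeast_Suc_atMost) simp
  also have "(\<Prod>k = Suc 1..Suc (length L'). ?f k) = (\<Prod>k = 1..length L'. ?f (Suc k))"
    by (rule prod.shift_bounds_cl_Suc_ivl)
  also have "\<dots> = (\<Prod>k = 1..length L'. w ((C # L') ! (k - 1)) ((C # L') ! k))"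
  proof (rule prod.cong[OF refl])
    fix k assume "k \<in> {1..length L'}"
    then show "?f (Suc k) = w ((C # L') ! (k - 1)) ((C # L') ! k)" by (cases k) auto
  qed
  finally show ?thesis by (simp add: chain_weight_def L mult_ac)
qed

text \<open>Unrolling the recursion for \<open>S\<close> produces one product per chain; the
  induction is on the number of elements outside \<open>A\<close>. Finiteness is proved along with
  it, since splitting the sum by the second set requires it.\<close>

lemma sum_chain_weight:
  fixes S :: "'a::linorder set \<Rightarrow> 'r::comm_ring_1"
  assumes "finite E" "A \<subseteq> E" and S_E: "S E = 1"
    and rec: "\<And>A. A \<subset> E \<Longrightarrow> S A = c * (\<Sum>F\<in>{insert (Min (E - A)) A..E}. w A F * S F)"
  shows "finite {L. up_chain E A L} \<and> (\<Sum>L\<in>{L. up_chain E A L}. chain_weight w c L) = S A"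
  using assms(2)
proof (induction "card (E - A)" arbitrary: A rule: less_induct)
  case less
  show ?case
  proof (cases "A = E")
    case True
    then show ?thesis using S_E by (simp add: up_chain_refl chain_weight_def)
  next
    case False
    then have AE: "A \<subset> E" using less.prems by blast
    let ?I = "{insert (Min (E - A)) A..E}"
    have m: "Min (E - A) \<in> E - A" using assms(1) AE by (intro Min_in) auto
    have IH: "finite {L. up_chain E C L}" "(\<Sum>L\<in>{L. up_chain E C L}. chain_weight w c L) = S C"
      if "C \<in> ?I" for C
    proof -
      have "card (E - C) < card (E - A)"
        using that m assms(1) by (intro psubset_card_mono) auto
      then show "finite {L. up_chain E C L}" "(\<Sum>L\<in>{L. up_chain E C L}. chain_weight w c L) = S C"
        using less.hyps[of C] that by auto
    qed
    have finI: "finite ?I" by (rule finite_set_interval[OF assms(1)])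
    have "(\<Sum>L\<in>{L. up_chain E A L}. chain_weight w c L) =
        (\<Sum>C\<in>?I. \<Sum>L\<in>(#) A ` {L. up_chain E C L}. chain_weight w c L)"
      unfolding up_chain_Union[OF assms(1) AE]
    proof (rule sum.UNION_disjoint)
      \<comment> \<open>The head of the tail determines \<open>C\<close>, so chains with different
        second sets are different.\<close>
      have "C = hd L" if "up_chain E C L" for C L using that by (simp add: up_chain_def)
      then show "\<forall>C\<in>?I. \<forall>C'\<in>?I. C \<noteq> C' \<longrightarrow>
          (#) A ` {L. up_chain E C L} \<inter> (#) A ` {L. up_chain E C' L} = {}" by blast
    qed (use finI IH(1) in auto)
    also have "\<dots> = (\<Sum>C\<in>?I. c * (w A C * S C))"
    proof (rule sum.cong[OF refl])
      fix C assume C: "C \<in> ?I"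
      have "(\<Sum>L\<in>(#) A ` {L. up_chain E C L}. chain_weight w c L) =
          (\<Sum>L\<in>{L. up_chain E C L}. c * (w A C * chain_weight w c L))"
        by (simp add: sum.reindex chain_weight_Cons)
      then show "(\<Sum>L\<in>(#) A ` {L. up_chain E C L}. chain_weight w c L) = c * (w A C * S C)"
        by (simp add: sum_distrib_left[symmetric] IH(2)[OF C])
    qed
    also have "\<dots> = S A" by (simp add: rec[OF AE] sum_distrib_left)
    finally show ?thesis using finI IH(1) by (simp add: up_chain_Union[OF assms(1) AE])
  qed
qed

section \<open>Complementation between increasing and decreasing chains\<close>

lemma down_chain_members:
  assumes "down_chain G L" "X \<in> set L"
  shows "X \<subseteq> G"
proof -
  have "k < length L \<Longrightarrow> L ! k \<subseteq> G" for k
  proof (induction k)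
    case 0
    then show ?case using assms(1) by (simp add: down_chain_def hd_conv_nth)
  next
    case (Suc k)
    then have "Suc k \<in> {1..length L - 1}" by auto
    then have "L ! Suc k \<subset> L ! (Suc k - 1)" using assms(1) unfolding down_chain_def by blast
    then show ?case using Suc by auto
  qed
  then show ?thesis using assms(2) by (auto simp: in_set_conv_nth)
qed

text \<open>Complementing within \<open>E\<close> reverses inclusions but leaves each difference of
  consecutive sets unchanged, so the block minima are the same and in the same order.\<close>

lemma map_complement_chain_iff:
  assumes "G \<subseteq> E" "\<And>X. X \<in> set L \<Longrightarrow> X \<subseteq> E"
  shows "up_chain E (E - G) (map (\<lambda>X. E - X) L) \<longleftrightarrow> down_chain G L"
proof (cases "L = []")
  case False
  have sub: "L ! k \<subseteq> E" if "k < length L" for k using that assms(2) by simp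
  have "hd L \<subseteq> E" "last L \<subseteq> E" using assms(2) False by auto
  then have "hd (map (\<lambda>X. E - X) L) = E - G \<longleftrightarrow> hd L = G"
    "last (map (\<lambda>X. E - X) L) = E \<longleftrightarrow> last L = {}"
    using False assms(1) by (auto simp: hd_map last_map)
  moreover have nth: "map (\<lambda>X. E - X) L ! (k - 1) \<subset> map (\<lambda>X. E - X) L ! k \<longleftrightarrow> L ! k \<subset> L ! (k - 1)"
    "map (\<lambda>X. E - X) L ! k - map (\<lambda>X. E - X) L ! (k - 1) = L ! (k - 1) - L ! k"
    if "k \<in> {1..length L - 1}" for k
  proof -
    have k: "k < length L" "k - 1 < length L" using that by auto
    show "map (\<lambda>X. E - X) L ! (k - 1) \<subset> map (\<lambda>X. E - X) L ! k \<longleftrightarrow> L ! k \<subset> L ! (k - 1)"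
      "map (\<lambda>X. E - X) L ! k - map (\<lambda>X. E - X) L ! (k - 1) = L ! (k - 1) - L ! k"
      unfolding nth_map[OF k(1)] nth_map[OF k(2)] using sub[OF k(1)] sub[OF k(2)] by blast+
  qed
  moreover have "(\<forall>k\<in>{1..length L - 1}. map (\<lambda>X. E - X) L ! (k - 1) \<subset> map (\<lambda>X. E - X) L ! k) \<longleftrightarrow>
      (\<forall>k\<in>{1..length L - 1}. L ! k \<subset> L ! (k - 1))"
    by (rule ball_cong[OF refl]) (rule nth(1))
  moreover have "strict_mono_on {1..length L - 1}
        (\<lambda>k. Min (map (\<lambda>X. E - X) L ! k - map (\<lambda>X. E - X) L ! (k - 1))) \<longleftrightarrow>
      strict_mono_on {1..length L - 1} (\<lambda>k. Min (L ! (k - 1) - L ! k))"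
    unfolding strict_mono_on_def by (intro iff_allI imp_cong refl) (simp only: nth(2))
  ultimately show ?thesis
    using False unfolding up_chain_def down_chain_def length_map map_is_Nil_conv by simp
qed (simp add: up_chain_def down_chain_def)

lemma bij_betw_complement_chains:
  assumes "G \<subseteq> E"
  shows "bij_betw (map (\<lambda>X. E - X)) {L. up_chain E (E - G) L} {L. down_chain G L}"
proof (rule bij_betw_byWitness[where f' = "map (\<lambda>X. E - X)"])
  have id: "map (\<lambda>X. E - X) (map (\<lambda>X. E - X) L) = L" if "\<And>X. X \<in> set L \<Longrightarrow> X \<subseteq> E" for L
    using that by (simp add: map_idI double_diff)
  have up: "X \<subseteq> E" if "up_chain E (E - G) L" "X \<in> set L" for L X
    using that up_chain_members by blast
  have down: "X \<subseteq> E" if "down_chain G L" "X \<in> set L" for L X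
    using that down_chain_members assms by blast
  show "\<forall>L\<in>{L. up_chain E (E - G) L}. map (\<lambda>X. E - X) (map (\<lambda>X. E - X) L) = L"
    using id up by blast
  show "\<forall>L\<in>{L. down_chain G L}. map (\<lambda>X. E - X) (map (\<lambda>X. E - X) L) = L"
    using id down by blast
  show "map (\<lambda>X. E - X) ` {L. up_chain E (E - G) L} \<subseteq> {L. down_chain G L}"
  proof safe
    fix L assume L: "up_chain E (E - G) L"
    then have "up_chain E (E - G) (map (\<lambda>X. E - X) (map (\<lambda>X. E - X) L))"
      using id[OF up[OF L]] by simp
    then show "down_chain G (map (\<lambda>X. E - X) L)"
      by (subst (asm) map_complement_chain_iff[OF assms]) auto
  qed
  show "map (\<lambda>X. E - X) ` {L. down_chain G L} \<subseteq> {L. up_chain E (E - G) L}"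
    using map_complement_chain_iff[OF assms] down by blast
qed

section \<open>The filtration expansion\<close>

lemma sum_up_chains:
  assumes "matroid M" "A \<subseteq> ground M"
  shows "finite {L. up_chain (ground M) A L}"
    "(\<Sum>L\<in>{L. up_chain (ground M) A L}.
       chain_weight (\<lambda>A F. of_int (beta (minor M F A))) varX L) = upper_sum M A"
proof -
  have fin: "finite (ground M)" by (rule matroid_finite_ground[OF assms(1)])
  have "upper_sum M A = varX * (\<Sum>F\<in>{insert (Min (ground M - A)) A..ground M}.
      of_int (beta (minor M F A)) * upper_sum M F)" if "A \<subset> ground M" for A
  proof (rule upper_sum_recursion[OF assms(1)])
    show "Min (ground M - A) \<in> ground M - A" using that fin by (intro Min_in) auto
  qed (use that in blast)
  from sum_chain_weight[OF fin assms(2) upper_sum_ground[OF assms(1)] this]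
  show "finite {L. up_chain (ground M) A L}" "(\<Sum>L\<in>{L. up_chain (ground M) A L}.
       chain_weight (\<lambda>A F. of_int (beta (minor M F A))) varX L) = upper_sum M A"
    by auto
qed

text \<open>Complementation transports the claim to increasing chains starting at
  \<open>ground M - G\<close>, where \<open>sum_chain_weight\<close> applies to the function sending
  \<open>A\<close> to \<open>lower_sum M (ground M - A)\<close>.\<close>

lemma sum_down_chains:
  assumes "matroid M" "G \<subseteq> ground M"
  shows "finite {L. down_chain G L}"
    "(\<Sum>L\<in>{L. down_chain G L}.
       chain_weight (\<lambda>A F. of_int (beta_dual (minor M A F))) varY L) = lower_sum M G"
proof -
  let ?E = "ground M"
  let ?w = "\<lambda>A F. of_int (beta_dual (minor M A F)) :: int poly poly"
  let ?w' = "\<lambda>A F. ?w (?E - A) (?E - F)"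
  note bij = bij_betw_complement_chains[OF assms(2)]
  have fin: "finite ?E" by (rule matroid_finite_ground[OF assms(1)])
  \<comment> \<open>This is \<open>lower_sum_recursion\<close> for the complement of
    \<open>A\<close> and its minimum: sets containing \<open>A\<close> and that minimum are the
    complements of subsets of the complement of \<open>A\<close> that avoid it.\<close>
  have rec: "lower_sum M (?E - A) =
      varY * (\<Sum>F\<in>{insert (Min (?E - A)) A..?E}. ?w' A F * lower_sum M (?E - F))" if "A \<subset> ?E" for A
  proof -
    let ?p = "Min (?E - A)"
    have p: "?p \<in> ?E - A" using fin that by (intro Min_in) auto
    have "(\<Sum>F\<in>{insert ?p A..?E}. ?w' A F * lower_sum M (?E - F)) =
        (\<Sum>F\<in>{{}..?E - A - {?p}}. ?w (?E - A) F * lower_sum M F)"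
      by (rule sum.reindex_bij_witness[of _ "\<lambda>F. ?E - F" "\<lambda>F. ?E - F"])
        (use p that in \<open>auto simp: double_diff\<close>)
    then show ?thesis using lower_sum_recursion[OF assms(1) p] by simp
  qed
  have "lower_sum M (?E - ?E) = 1" using lower_sum_empty[OF assms(1)] by simp
  from sum_chain_weight[where S = "\<lambda>A. lower_sum M (?E - A)", OF fin _ this rec, of "?E - G"]
  have *: "finite {L. up_chain ?E (?E - G) L}"
    "(\<Sum>L\<in>{L. up_chain ?E (?E - G) L}. chain_weight ?w' varY L) = lower_sum M G"
    using assms(2) by (auto simp: double_diff)
  show "finite {L. down_chain G L}" using bij_betw_finite[OF bij] *(1) by simp
  have "(\<Sum>L\<in>{L. down_chain G L}. chain_weight ?w varY L) =
      (\<Sum>L\<in>{L. up_chain ?E (?E - G) L}. chain_weight ?w varY (map (\<lambda>X. ?E - X) L))"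
    by (rule sum.reindex_bij_betw[OF bij, symmetric])
  also have "\<dots> = (\<Sum>L\<in>{L. up_chain ?E (?E - G) L}. chain_weight ?w' varY L)"
  proof (rule sum.cong[OF refl])
    fix L :: "'a set list"
    show "chain_weight ?w varY (map (\<lambda>X. ?E - X) L) = chain_weight ?w' varY L"
      unfolding chain_weight_def length_map
    proof (intro arg_cong2[where f = "(*)"] prod.cong refl)
      fix k assume "k \<in> {1..length L - 1}"
      then have "k < length L" "k - 1 < length L" by auto
      then show "?w (map (\<lambda>X. ?E - X) L ! (k - 1)) (map (\<lambda>X. ?E - X) L ! k) = ?w' (L ! (k - 1)) (L ! k)"
        by simp
    qed
  qed
  finally show "(\<Sum>L\<in>{L. down_chain G L}. chain_weight ?w varY L) = lower_sum M G" using *(2) by simp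
qed

text \<open>The inclusion of \<open>Fc\<close> is recorded explicitly because it gives the index
  range of the outer sum over \<open>Fc\<close>.\<close>

lemma filtration_iff_chains:
  "filtration E F' Fc F \<longleftrightarrow> Fc \<subseteq> E \<and> down_chain Fc F' \<and> up_chain E Fc F"
proof -
  have "filtration E F' Fc F \<longleftrightarrow> down_chain Fc F' \<and> up_chain E Fc F"
    unfolding filtration_def up_chain_def down_chain_def by blast
  then show ?thesis using up_chain_subset by blast
qed

lemma filtration_term_eq:
  "filtration_term M F' F = chain_weight (\<lambda>A F. of_int (beta_dual (minor M A F))) varY F' *
     chain_weight (\<lambda>A F. of_int (beta (minor M F A))) varX F"
  by (simp add: filtration_term_def chain_weight_def of_int_prod mult_ac)

text \<open>Once \<open>Fc\<close> is fixed, the two parts of a filtration vary independently; the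
  reordering of the triple puts \<open>Fc\<close> first so that the set becomes a dependent
  product.\<close>

lemma filtrations_eq_Sigma:
  "{(F', Fc, F). filtration E F' Fc F} = (\<lambda>(Fc, F', F). (F', Fc, F)) `
     (SIGMA Fc:{{}..E}. {F'. down_chain Fc F'} \<times> {F. up_chain E Fc F})"
proof (intro equalityI subsetI)
  fix t assume t: "t \<in> {(F', Fc, F). filtration E F' Fc F}"
  obtain F' Fc F where "t = (F', Fc, F)" by (cases t)
  with t show "t \<in> (\<lambda>(Fc, F', F). (F', Fc, F)) `
      (SIGMA Fc:{{}..E}. {F'. down_chain Fc F'} \<times> {F. up_chain E Fc F})"
    by (intro rev_image_eqI[of "(Fc, F', F)"]) (auto simp: filtration_iff_chains)
qed (auto simp: filtration_iff_chains)

lemma finite_filtrations: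
  assumes "matroid M"
  shows "finite {(F', Fc, F). filtration (ground M) F' Fc F}"
proof -
  have "finite (SIGMA Fc:{{}..ground M}. {F'. down_chain Fc F'} \<times> {F. up_chain (ground M) Fc F})"
  proof (rule finite_SigmaI)
    show "finite {{}..ground M}" by (rule finite_set_interval[OF matroid_finite_ground[OF assms]])
    fix Fc assume "Fc \<in> {{}..ground M}"
    then have "Fc \<subseteq> ground M" by simp
    then show "finite ({F'. down_chain Fc F'} \<times> {F. up_chain (ground M) Fc F})"
      using sum_up_chains(1)[OF assms] sum_down_chains(1)[OF assms] by simp
  qed
  then show ?thesis unfolding filtrations_eq_Sigma by (rule finite_imageI)
qed

text \<open>For fixed \<open>Fc\<close> the sum of products over both parts factors into
  \<open>lower_sum M Fc * upper_sum M Fc\<close>, and \<open>tutte_convolution\<close> sums these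
  over \<open>Fc\<close>.\<close>

lemma tutte_filtrations:
  assumes "matroid M"
  shows "tutte M = (\<Sum>(F', Fc, F)\<in>{(F', Fc, F). filtration (ground M) F' Fc F}. filtration_term M F' F)"
proof -
  let ?E = "ground M"
  let ?S = "\<lambda>Fc. {F'. down_chain Fc F'} \<times> {F. up_chain ?E Fc F}"
  have inj: "inj_on (\<lambda>(Fc, F', F). (F', Fc, F)) (SIGMA Fc:{{}..?E}. ?S Fc)"
    by (auto simp: inj_on_def)
  have "(\<Sum>(F', Fc, F)\<in>{(F', Fc, F). filtration ?E F' Fc F}. filtration_term M F' F) =
      (\<Sum>(Fc, F', F)\<in>(SIGMA Fc:{{}..?E}. ?S Fc). filtration_term M F' F)"
    unfolding filtrations_eq_Sigma sum.reindex[OF inj] by (simp add: o_def split_def)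
  also have "\<dots> = (\<Sum>Fc\<in>{{}..?E}. \<Sum>(F', F)\<in>?S Fc. filtration_term M F' F)"
    by (rule sum.Sigma[symmetric])
      (use sum_up_chains(1)[OF assms] sum_down_chains(1)[OF assms] in
        \<open>auto intro!: finite_set_interval matroid_finite_ground[OF assms]\<close>)
  also have "\<dots> = (\<Sum>Fc\<in>{{}..?E}. lower_sum M Fc * upper_sum M Fc)"
    by (rule sum.cong[OF refl])
      (auto simp: filtration_term_eq sum.cartesian_product[symmetric] sum_product[symmetric]
        sum_up_chains(2)[OF assms] sum_down_chains(2)[OF assms])
  finally show ?thesis using tutte_convolution[OF assms] by simp
qed

text \<open>Failure of connectedness singles out one block that is disconnected, or a loop in the
  upper part, or an isthmus in the lower part; its factor in the product is zero.\<close>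

lemma filtration_term_not_connected:
  assumes "matroid M" "filtration (ground M) F' Fc F" "\<not> connected_filtration M F' Fc F"
  shows "filtration_term M F' F = 0"
proof -
  let ?E = "ground M"
  have up: "up_chain ?E Fc F" and down: "down_chain Fc F'" and Fc: "Fc \<subseteq> ?E"
    using assms(2) by (simp_all add: filtration_iff_chains)
  have upm: "matroid (minor M (F ! k) (F ! (k - 1)))" if "k \<in> {1..length F - 1}" for k
  proof (rule matroid_minor[OF assms(1)])
    show "F ! (k - 1) \<subseteq> F ! k" using up that unfolding up_chain_def by blast
    have "k < length F" using that by auto
    then show "F ! k \<subseteq> ?E" using up_chain_members[OF up nth_mem] by blast
  qed
  have downm: "matroid (minor M (F' ! (k - 1)) (F' ! k))" if "k \<in> {1..length F' - 1}" for k
  proof (rule matroid_minor[OF assms(1)])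
    show "F' ! k \<subseteq> F' ! (k - 1)" using down that unfolding down_chain_def by blast
    have "k - 1 < length F'" using that by auto
    then show "F' ! (k - 1) \<subseteq> ?E" using down_chain_members[OF down nth_mem] Fc by blast
  qed
  consider (up) k where "k \<in> {1..length F - 1}" "beta (minor M (F ! k) (F ! (k - 1))) = 0"
    | (down) k where "k \<in> {1..length F' - 1}" "beta_dual (minor M (F' ! (k - 1)) (F' ! k)) = 0"
  proof -
    consider k where "k \<in> {1..length F - 1}" "\<not> connected_matroid (minor M (F ! k) (F ! (k - 1)))
        \<or> is_loop (minor M (F ! k) (F ! (k - 1)))"
      | k where "k \<in> {1..length F' - 1}" "\<not> connected_matroid (minor M (F' ! (k - 1)) (F' ! k))
        \<or> is_isthmus (minor M (F' ! (k - 1)) (F' ! k))"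
      using assms(2,3) unfolding connected_filtration_def by blast
    then show ?thesis
    proof cases
      case (1 k)
      then show ?thesis
        using that(1) beta_disconnected(1)[OF upm[OF 1(1)]] beta_loop[OF upm[OF 1(1)]] by metis
    next
      case (2 k)
      then show ?thesis
        using that(2) beta_disconnected(2)[OF downm[OF 2(1)]] beta_dual_isthmus[OF downm[OF 2(1)]]
        by metis
    qed
  qed
  then show ?thesis
  proof cases
    case up
    then have "(\<Prod>k = 1..length F - 1. beta (minor M (F ! k) (F ! (k - 1)))) = 0"
      by (intro prod_zero) auto
    then show ?thesis by (simp add: filtration_term_def)
  next
    case down
    then have "(\<Prod>k = 1..length F' - 1. beta_dual (minor M (F' ! (k - 1)) (F' ! k))) = 0"
      by (intro prod_zero) auto
    then show ?thesis by (simp add: filtration_term_def)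
  qed
qed

theorem theorem3p5:
  fixes M :: "'a::linorder set_system"
  assumes "matroid M"
  shows "tutte M =
           (\<Sum>(F', Fc, F)\<in>{(F', Fc, F). connected_filtration M F' Fc F}. filtration_term M F' F)
       \<and> tutte M =
           (\<Sum>(F', Fc, F)\<in>{(F', Fc, F). filtration (ground M) F' Fc F}. filtration_term M F' F)"
proof -
  have "(\<Sum>(F', Fc, F)\<in>{(F', Fc, F). connected_filtration M F' Fc F}. filtration_term M F' F) =
      (\<Sum>(F', Fc, F)\<in>{(F', Fc, F). filtration (ground M) F' Fc F}. filtration_term M F' F)"
    \<comment> \<open>The connected filtrations form a subset of the finite set of all filtrations,
      and the terms outside it vanish.\<close>
    by (rule sum.mono_neutral_left[OF finite_filtrations[OF assms]])
      (auto simp: connected_filtration_def[of M] intro: filtration_term_not_connected[OF assms])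
  then show ?thesis using tutte_filtrations[OF assms] by simp
qed

end
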